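(* Let $\Pi=\Pi(\Gamma,\lambda,\mathcal{G})$ be a periagroup and let $g\in\Pi$. A word $w$ representing $g$ has minimal length among all the words representing $g$ if and only if it is graphically reduced. Moreover, any two graphically reduced words representing $g$ can be obtained from each other by applying dihedral relations.
   Context: Let $\Gamma$ be a simplicial graph, $\lambda:E(\Gamma)\to\mathbb{N}_{\geq 2}$ a labelling of its edges, and $\mathcal{G}=\{G_u\mid u\in V(\Gamma)\}$ a collection of groups indexed by the vertices of $\Gamma$ (the vertex-groups) such that for every edge $\{u,v\}$, if $\lambda(u,v)>2$ then $G_u,G_v$ have order two. The periagroup $\Pi(\Gamma,\lambda,\mathcal{G})$ is the quotient of the free product of the $G_u$ by the relations $\langle a,b\rangle^{\lambda(u,v)}=\langle b,a\rangle^{\lambda(u,v)}$ for all $\{u,v\}\in E(\Gamma)$ and all non-trivial $a\in G_u$, $b\in G_v$, where $\langle a,b\rangle^k$ is the word formed by the first $k$ letters of $ababab\cdots$. A word in $\Pi$ is a formal product $g_1\cdots g_n$ where $n\geq0$ and each $g_i$ belongs to some vertex-group; the $g_i$ are its syllables and $n$ is its length. The following elementary moves on words do not change the element of $\Pi$ represented: (reduction) remove the syllable $g_i$ if $g_i=1$; (fusion) if $g_i,g_{i+1}\in G$ for some $G\in\mathcal{G}$, replace the two syllables $g_i,g_{i+1}$ with the single syllable $g_ig_{i+1}\in G$; (dihedral relation) if there is $\{u,v\}\in E(\Gamma)$ such that the subword $g_i\cdots g_{i+\lambda(u,v)-1}$ is $\langle a,b\rangle^{\lambda(u,v)}$ for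 some non-trivial $a\in G_u$, $b\in G_v$, replace this subword with $\langle b,a\rangle^{\lambda(u,v)}$. A word is graphically reduced if its length cannot be shortened by applying (a sequence of) these elementary moves. *)

theory Defs
  imports "HOL-Algebra.Generated_Groups"
begin

definition simplicial_graph :: "'v set \<Rightarrow> 'v set set \<Rightarrow> bool" where
  "simplicial_graph V E \<longleftrightarrow> (\<forall>e\<in>E. \<exists>u\<in>V. \<exists>v\<in>V. u \<noteq> v \<and> e = {u, v})"

text \<open>The graph may be infinite. All vertex-groups live in one ambient type of elements, which
  costs nothing: they are treated as unrelated groups, because syllables carry their vertex.\<close>

definition periagroup_data ::
    "'v set \<Rightarrow> 'v set set \<Rightarrow> ('v set \<Rightarrow> nat) \<Rightarrow> ('v \<Rightarrow> ('a, 'b) monoid_scheme) \<Rightarrow> bool" where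
  "periagroup_data V E lab G \<longleftrightarrow>
     simplicial_graph V E \<and>
     (\<forall>e\<in>E. 2 \<le> lab e) \<and>
     (\<forall>u\<in>V. group (G u)) \<and>
     (\<forall>u v. {u, v} \<in> E \<and> 2 < lab {u, v} \<longrightarrow> order (G u) = 2 \<and> order (G v) = 2)"

type_synonym ('v, 'a) word = "('v \<times> 'a) list"

definition words :: "'v set \<Rightarrow> ('v \<Rightarrow> ('a, 'b) monoid_scheme) \<Rightarrow> ('v, 'a) word set" where
  "words V G = lists (SIGMA u:V. carrier (G u))"

fun alternating :: "'s \<Rightarrow> 's \<Rightarrow> nat \<Rightarrow> 's list" where
  "alternating a b 0 = []"
| "alternating a b (Suc k) = a # alternating b a k"

inductive reduction_move ::
    "'v set \<Rightarrow> ('v \<Rightarrow> ('a, 'b) monoid_scheme) \<Rightarrow> ('v, 'a) word \<Rightarrow> ('v, 'a) word \<Rightarrow> bool"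
  for V G where
  "\<lbrakk>u \<in> V; x \<in> words V G; y \<in> words V G\<rbrakk>
    \<Longrightarrow> reduction_move V G (x @ [(u, \<one>\<^bsub>G u\<^esub>)] @ y) (x @ y)"

inductive fusion_move ::
    "'v set \<Rightarrow> ('v \<Rightarrow> ('a, 'b) monoid_scheme) \<Rightarrow> ('v, 'a) word \<Rightarrow> ('v, 'a) word \<Rightarrow> bool"
  for V G where
  "\<lbrakk>u \<in> V; a \<in> carrier (G u); b \<in> carrier (G u); x \<in> words V G; y \<in> words V G\<rbrakk>
    \<Longrightarrow> fusion_move V G (x @ [(u, a), (u, b)] @ y) (x @ [(u, a \<otimes>\<^bsub>G u\<^esub> b)] @ y)"

inductive dihedral_move ::
    "'v set \<Rightarrow> 'v set set \<Rightarrow> ('v set \<Rightarrow> nat) \<Rightarrow> ('v \<Rightarrow> ('a, 'b) monoid_scheme)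
      \<Rightarrow> ('v, 'a) word \<Rightarrow> ('v, 'a) word \<Rightarrow> bool"
  for V E lab G where
  "\<lbrakk>{u, v} \<in> E; a \<in> carrier (G u) - {\<one>\<^bsub>G u\<^esub>}; b \<in> carrier (G v) - {\<one>\<^bsub>G v\<^esub>};
    x \<in> words V G; y \<in> words V G\<rbrakk>
    \<Longrightarrow> dihedral_move V E lab G
          (x @ alternating (u, a) (v, b) (lab {u, v}) @ y)
          (x @ alternating (v, b) (u, a) (lab {u, v}) @ y)"

definition elementary_move ::
    "'v set \<Rightarrow> 'v set set \<Rightarrow> ('v set \<Rightarrow> nat) \<Rightarrow> ('v \<Rightarrow> ('a, 'b) monoid_scheme)
      \<Rightarrow> ('v, 'a) word \<Rightarrow> ('v, 'a) word \<Rightarrow> bool" where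
  "elementary_move V E lab G w w' \<longleftrightarrow>
     reduction_move V G w w' \<or> fusion_move V G w w' \<or> dihedral_move V E lab G w w'"

definition graphically_reduced ::
    "'v set \<Rightarrow> 'v set set \<Rightarrow> ('v set \<Rightarrow> nat) \<Rightarrow> ('v \<Rightarrow> ('a, 'b) monoid_scheme)
      \<Rightarrow> ('v, 'a) word \<Rightarrow> bool" where
  "graphically_reduced V E lab G w \<longleftrightarrow>
     w \<in> words V G \<and>
     \<not> (\<exists>w'. (elementary_move V E lab G)\<^sup>*\<^sup>* w w' \<and> length w' < length w)"


text \<open>The free product of the vertex-groups: words modulo the equivalence relation generated by
  reduction and fusion, multiplied by concatenation.\<close>

definition free_product_rel ::
    "'v set \<Rightarrow> ('v \<Rightarrow> ('a, 'b) monoid_scheme) \<Rightarrow> (('v, 'a) word \<times> ('v, 'a) word) set" where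
  "free_product_rel V G = {(w, w'). w \<in> words V G \<and> w' \<in> words V G \<and>
     equivclp (\<lambda>s t. reduction_move V G s t \<or> fusion_move V G s t) w w'}"

definition free_product ::
    "'v set \<Rightarrow> ('v \<Rightarrow> ('a, 'b) monoid_scheme) \<Rightarrow> ('v, 'a) word set monoid" where
  "free_product V G =
     \<lparr>carrier = words V G // free_product_rel V G,
      mult = (\<lambda>X Y. \<Union>x\<in>X. \<Union>y\<in>Y. free_product_rel V G `` {x @ y}),
      one = free_product_rel V G `` {[]}\<rparr>"

definition free_product_incl ::
    "'v set \<Rightarrow> ('v \<Rightarrow> ('a, 'b) monoid_scheme) \<Rightarrow> 'v \<times> 'a \<Rightarrow> ('v, 'a) word set" where
  "free_product_incl V G s = free_product_rel V G `` {[s]}"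

definition free_product_val ::
    "'v set \<Rightarrow> ('v \<Rightarrow> ('a, 'b) monoid_scheme) \<Rightarrow> ('v, 'a) word \<Rightarrow> ('v, 'a) word set" where
  "free_product_val V G w =
     foldr (\<otimes>\<^bsub>free_product V G\<^esub>) (map (free_product_incl V G) w) \<one>\<^bsub>free_product V G\<^esub>"

definition normal_closure :: "('g, 'c) monoid_scheme \<Rightarrow> 'g set \<Rightarrow> 'g set" where
  "normal_closure H R =
     generate H {x \<otimes>\<^bsub>H\<^esub> r \<otimes>\<^bsub>H\<^esub> inv\<^bsub>H\<^esub> x | x r. x \<in> carrier H \<and> r \<in> R}"

definition periagroup_relators ::
    "'v set \<Rightarrow> 'v set set \<Rightarrow> ('v set \<Rightarrow> nat) \<Rightarrow> ('v \<Rightarrow> ('a, 'b) monoid_scheme)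
      \<Rightarrow> ('v, 'a) word set set" where
  "periagroup_relators V E lab G =
     {free_product_val V G (alternating (u, a) (v, b) (lab {u, v})) \<otimes>\<^bsub>free_product V G\<^esub>
        inv\<^bsub>free_product V G\<^esub> (free_product_val V G (alternating (v, b) (u, a) (lab {u, v})))
      | u v a b. {u, v} \<in> E \<and> a \<in> carrier (G u) - {\<one>\<^bsub>G u\<^esub>} \<and> b \<in> carrier (G v) - {\<one>\<^bsub>G v\<^esub>}}"

definition periagroup_kernel ::
    "'v set \<Rightarrow> 'v set set \<Rightarrow> ('v set \<Rightarrow> nat) \<Rightarrow> ('v \<Rightarrow> ('a, 'b) monoid_scheme)
      \<Rightarrow> ('v, 'a) word set set" where
  "periagroup_kernel V E lab G =
     normal_closure (free_product V G) (periagroup_relators V E lab G)"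

definition periagroup ::
    "'v set \<Rightarrow> 'v set set \<Rightarrow> ('v set \<Rightarrow> nat) \<Rightarrow> ('v \<Rightarrow> ('a, 'b) monoid_scheme)
      \<Rightarrow> ('v, 'a) word set set monoid" where
  "periagroup V E lab G = free_product V G Mod periagroup_kernel V E lab G"

definition periagroup_incl ::
    "'v set \<Rightarrow> 'v set set \<Rightarrow> ('v set \<Rightarrow> nat) \<Rightarrow> ('v \<Rightarrow> ('a, 'b) monoid_scheme)
      \<Rightarrow> 'v \<times> 'a \<Rightarrow> ('v, 'a) word set set" where
  "periagroup_incl V E lab G s =
     periagroup_kernel V E lab G #>\<^bsub>free_product V G\<^esub> free_product_incl V G s"

definition periagroup_val ::
    "'v set \<Rightarrow> 'v set set \<Rightarrow> ('v set \<Rightarrow> nat) \<Rightarrow> ('v \<Rightarrow> ('a, 'b) monoid_scheme)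
      \<Rightarrow> ('v, 'a) word \<Rightarrow> ('v, 'a) word set set" where
  "periagroup_val V E lab G w =
     foldr (\<otimes>\<^bsub>periagroup V E lab G\<^esub>) (map (periagroup_incl V E lab G) w)
       \<one>\<^bsub>periagroup V E lab G\<^esub>"

definition represents ::
    "'v set \<Rightarrow> 'v set set \<Rightarrow> ('v set \<Rightarrow> nat) \<Rightarrow> ('v \<Rightarrow> ('a, 'b) monoid_scheme)
      \<Rightarrow> ('v, 'a) word \<Rightarrow> ('v, 'a) word set set \<Rightarrow> bool" where
  "represents V E lab G w g \<longleftrightarrow> w \<in> words V G \<and> periagroup_val V E lab G w = g"


subsection \<open>The constructions are groups, and the free product has its universal property\<close>

lemma words_append_iff [simp]: "x @ y \<in> words V G \<longleftrightarrow> x \<in> words V G \<and> y \<in> words V G"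
  by (auto simp: words_def)

lemma words_Nil [simp]: "[] \<in> words V G"
  by (simp add: words_def)

lemma words_Cons [simp]:
  "(u, a) # w \<in> words V G \<longleftrightarrow> u \<in> V \<and> a \<in> carrier (G u) \<and> w \<in> words V G"
  by (auto simp: words_def)

lemma equiv_free_product_rel: "equiv (words V G) (free_product_rel V G)"
  by (rule equivI)
     (auto simp: free_product_rel_def refl_on_def sym_def trans_def
        intro: equivclp_sym equivclp_trans)

lemma fp_move_context:
  assumes "reduction_move V G s t \<or> fusion_move V G s t" "p \<in> words V G" "q \<in> words V G"
  shows "reduction_move V G (p @ s @ q) (p @ t @ q) \<or> fusion_move V G (p @ s @ q) (p @ t @ q)"
  using assms(1)
proof
  assume "reduction_move V G s t"
  then show ?thesis
  proof cases
    case (1 u x y)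
    then show ?thesis
      using reduction_move.intros[of u V "p @ x" G "y @ q"] assms by simp
  qed
next
  assume "fusion_move V G s t"
  then show ?thesis
  proof cases
    case (1 u a b x y)
    then show ?thesis
      using fusion_move.intros[of u V a G b "p @ x" "y @ q"] assms by simp
  qed
qed

lemma fp_rel_context:
  assumes "(s, t) \<in> free_product_rel V G" "p \<in> words V G" "q \<in> words V G"
  shows "(p @ s @ q, p @ t @ q) \<in> free_product_rel V G"
proof -
  let ?R = "\<lambda>s t. reduction_move V G s t \<or> fusion_move V G s t"
  have "equivclp ?R s t" using assms(1) by (simp add: free_product_rel_def)
  then have "equivclp ?R (p @ s @ q) (p @ t @ q)"
  proof (induction rule: equivclp_induct)
    case base
    then show ?case by simp
  next
    case (step y z)
    then have "?R (p @ y @ q) (p @ z @ q) \<or> ?R (p @ z @ q) (p @ y @ q)"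
      using fp_move_context[OF _ assms(2,3)] by blast
    with step.IH show ?case by (rule equivclp_into_equivclp)
  qed
  then show ?thesis using assms by (simp add: free_product_rel_def)
qed

lemma fp_mult_congruent:
  "congruent2 (free_product_rel V G) (free_product_rel V G)
     (\<lambda>x y. free_product_rel V G `` {x @ y})"
proof (rule congruent2I[OF equiv_free_product_rel equiv_free_product_rel])
  fix y z w assume "(y, z) \<in> free_product_rel V G" "w \<in> words V G"
  then have "(y @ w, z @ w) \<in> free_product_rel V G"
    using fp_rel_context[of y z V G "[]" w] by simp
  then show "free_product_rel V G `` {y @ w} = free_product_rel V G `` {z @ w}"
    by (rule equiv_class_eq[OF equiv_free_product_rel])
next
  fix y z w assume "(y, z) \<in> free_product_rel V G" "w \<in> words V G"
  then have "(w @ y, w @ z) \<in> free_product_rel V G"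
    using fp_rel_context[of y z V G w "[]"] by simp
  then show "free_product_rel V G `` {w @ y} = free_product_rel V G `` {w @ z}"
    by (rule equiv_class_eq[OF equiv_free_product_rel])
qed

lemma fp_mult:
  assumes "x \<in> words V G" "y \<in> words V G"
  shows "free_product_rel V G `` {x} \<otimes>\<^bsub>free_product V G\<^esub> free_product_rel V G `` {y}
    = free_product_rel V G `` {x @ y}"
  using UN_equiv_class2[OF equiv_free_product_rel equiv_free_product_rel
      fp_mult_congruent assms]
  by (simp only: free_product_def monoid.simps)

lemma fp_carrierE:
  assumes "X \<in> carrier (free_product V G)"
  obtains x where "x \<in> words V G" "X = free_product_rel V G `` {x}"
  using assms unfolding free_product_def by (auto elim!: quotientE)

lemma fp_class_in_carrier:
  "x \<in> words V G \<Longrightarrow> free_product_rel V G `` {x} \<in> carrier (free_product V G)"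
  by (simp add: free_product_def quotientI)

lemma fp_one: "\<one>\<^bsub>free_product V G\<^esub> = free_product_rel V G `` {[]}"
  by (simp add: free_product_def)

lemma fp_left_inverse:
  assumes "\<forall>u\<in>V. group (G u)" "w \<in> words V G"
  shows "\<exists>w'\<in>words V G. (w' @ w, []) \<in> free_product_rel V G"
  using assms(2)
proof (induction w)
  case Nil
  then show ?case by (intro bexI[of _ "[]"]) (auto simp: free_product_rel_def)
next
  case (Cons s w)
  obtain u a where s: "s = (u, a)" by force
  have u: "u \<in> V" and a: "a \<in> carrier (G u)" and w: "w \<in> words V G"
    using Cons.prems s by auto
  interpret Gu: group "G u" using assms(1) u by blast
  obtain w' where w': "w' \<in> words V G" "(w' @ w, []) \<in> free_product_rel V G"
    using Cons.IH w by blast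
  let ?i = "inv\<^bsub>G u\<^esub> a"
  have "fusion_move V G ([] @ [(u, ?i), (u, a)] @ []) ([] @ [(u, ?i \<otimes>\<^bsub>G u\<^esub> a)] @ [])"
    by (rule fusion_move.intros) (use u a in auto)
  moreover have "reduction_move V G ([] @ [(u, \<one>\<^bsub>G u\<^esub>)] @ []) ([] @ [])"
    by (rule reduction_move.intros) (use u in auto)
  ultimately have "([(u, ?i), (u, a)], []) \<in> free_product_rel V G"
    using u a by (auto simp: free_product_rel_def
        intro!: equivclp_trans[OF r_into_equivclp r_into_equivclp])
  from fp_rel_context[OF this w'(1) w]
  have "((w' @ [(u, ?i)]) @ s # w, w' @ w) \<in> free_product_rel V G"
    by (simp add: s)
  moreover have "trans (free_product_rel V G)"
    using equiv_free_product_rel by (auto simp: equiv_def)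
  ultimately have "((w' @ [(u, ?i)]) @ s # w, []) \<in> free_product_rel V G"
    using w'(2) by (meson transD)
  then show ?case using w' u a by (intro bexI[of _ "w' @ [(u, ?i)]"]) auto
qed

lemma group_free_product:
  assumes "\<forall>u\<in>V. group (G u)"
  shows "group (free_product V G)"
proof (rule groupI)
  fix X Y assume "X \<in> carrier (free_product V G)" "Y \<in> carrier (free_product V G)"
  then show "X \<otimes>\<^bsub>free_product V G\<^esub> Y \<in> carrier (free_product V G)"
    by (metis fp_carrierE fp_class_in_carrier fp_mult words_append_iff)
next
  show "\<one>\<^bsub>free_product V G\<^esub> \<in> carrier (free_product V G)"
    by (simp add: fp_one fp_class_in_carrier)
next
  fix X Y Z
  assume "X \<in> carrier (free_product V G)" "Y \<in> carrier (free_product V G)"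
    "Z \<in> carrier (free_product V G)"
  then show "X \<otimes>\<^bsub>free_product V G\<^esub> Y \<otimes>\<^bsub>free_product V G\<^esub> Z
      = X \<otimes>\<^bsub>free_product V G\<^esub> (Y \<otimes>\<^bsub>free_product V G\<^esub> Z)"
    by (auto elim!: fp_carrierE simp: fp_mult)
next
  fix X assume "X \<in> carrier (free_product V G)"
  then show "\<one>\<^bsub>free_product V G\<^esub> \<otimes>\<^bsub>free_product V G\<^esub> X = X"
    by (auto elim!: fp_carrierE simp: fp_mult fp_one)
next
  fix X assume "X \<in> carrier (free_product V G)"
  then obtain x where x: "x \<in> words V G" "X = free_product_rel V G `` {x}"
    by (rule fp_carrierE)
  obtain w where w: "w \<in> words V G" "(w @ x, []) \<in> free_product_rel V G"
    using fp_left_inverse[OF assms x(1)] by blast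
  show "\<exists>Y\<in>carrier (free_product V G). Y \<otimes>\<^bsub>free_product V G\<^esub> X = \<one>\<^bsub>free_product V G\<^esub>"
    using w x equiv_class_eq[OF equiv_free_product_rel w(2)]
    by (intro bexI[of _ "free_product_rel V G `` {w}"])
       (auto simp: fp_mult fp_one fp_class_in_carrier)
qed

lemma free_product_val_eq:
  "w \<in> words V G \<Longrightarrow> free_product_val V G w = free_product_rel V G `` {w}"
proof (induction w)
  case Nil
  then show ?case by (simp add: free_product_val_def fp_one)
next
  case (Cons s w)
  obtain u a where s: "s = (u, a)" by force
  then have "free_product_val V G w = free_product_rel V G `` {w}" "[s] \<in> words V G" "w \<in> words V G"
    using Cons by auto
  then show ?case
    using fp_mult[of "[s]" V G w] by (simp add: free_product_val_def free_product_incl_def)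
qed

lemma free_product_incl_hom:
  assumes "u \<in> V" "group (G u)"
  shows "(\<lambda>a. free_product_incl V G (u, a)) \<in> hom (G u) (free_product V G)"
proof (rule homI)
  fix a assume "a \<in> carrier (G u)"
  then show "free_product_incl V G (u, a) \<in> carrier (free_product V G)"
    using assms by (simp add: free_product_incl_def fp_class_in_carrier)
next
  interpret Gu: group "G u" by (rule assms(2))
  fix a b assume ab: "a \<in> carrier (G u)" "b \<in> carrier (G u)"
  have "fusion_move V G ([] @ [(u, a), (u, b)] @ []) ([] @ [(u, a \<otimes>\<^bsub>G u\<^esub> b)] @ [])"
    by (rule fusion_move.intros) (use assms ab in auto)
  then have "([(u, a), (u, b)], [(u, a \<otimes>\<^bsub>G u\<^esub> b)]) \<in> free_product_rel V G"
    using assms ab by (auto simp: free_product_rel_def)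
  from equiv_class_eq[OF equiv_free_product_rel this]
  show "free_product_incl V G (u, a \<otimes>\<^bsub>G u\<^esub> b)
      = free_product_incl V G (u, a) \<otimes>\<^bsub>free_product V G\<^esub> free_product_incl V G (u, b)"
    using assms ab by (simp add: free_product_incl_def fp_mult)
qed

lemma free_product_universal:
  assumes G: "\<forall>u\<in>V. group (G u)" and H: "group H"
    and f: "\<And>u. u \<in> V \<Longrightarrow> f u \<in> hom (G u) H"
  shows "\<exists>h\<in>hom (free_product V G) H. \<forall>u\<in>V. \<forall>a\<in>carrier (G u).
    h (free_product_incl V G (u, a)) = f u a"
proof -
  interpret H: group H by (rule H)
  define ev where "ev w = foldr (\<lambda>(u, a) y. f u a \<otimes>\<^bsub>H\<^esub> y) w \<one>\<^bsub>H\<^esub>" for w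
  have ev_simps [simp]: "ev [] = \<one>\<^bsub>H\<^esub>" "ev ((u, a) # w) = f u a \<otimes>\<^bsub>H\<^esub> ev w" for u a w
    by (simp_all add: ev_def)
  have f_closed [simp]: "f u a \<in> carrier H" if "u \<in> V" "a \<in> carrier (G u)" for u a
    using f[OF that(1)] that(2) by (rule hom_in_carrier)
  have ev_closed [simp]: "ev w \<in> carrier H" if "w \<in> words V G" for w
    using that by (induction w) auto
  have ev_append [simp]: "ev (x @ y) = ev x \<otimes>\<^bsub>H\<^esub> ev y"
    if "x \<in> words V G" "y \<in> words V G" for x y
    using that by (induction x) (auto simp: H.m_assoc)
  have red: "ev s = ev t" if "reduction_move V G s t" for s t
    using that
  proof cases
    case (1 u x y)
    have "f u \<one>\<^bsub>G u\<^esub> = \<one>\<^bsub>H\<^esub>" using G H f 1 hom_one by blast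
    moreover have "\<one>\<^bsub>G u\<^esub> \<in> carrier (G u)"
      using G 1 by (simp add: group.is_monoid monoid.one_closed)
    ultimately show ?thesis using 1 by simp
  qed
  have fus: "ev s = ev t" if "fusion_move V G s t" for s t
    using that
  proof cases
    case (1 u a b x y)
    have "a \<otimes>\<^bsub>G u\<^esub> b \<in> carrier (G u)"
      using G 1 by (simp add: group.is_monoid monoid.m_closed)
    then show ?thesis using 1 hom_mult[OF f] by (simp add: H.m_assoc)
  qed
  have ev_rel: "ev s = ev t" if "(s, t) \<in> free_product_rel V G" for s t
  proof -
    have "equivclp (\<lambda>s t. reduction_move V G s t \<or> fusion_move V G s t) s t"
      using that by (simp add: free_product_rel_def)
    then show ?thesis
    proof (induction rule: equivclp_induct)
      case base
      then show ?case by simp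
    next
      case (step y z)
      then show ?case using red fus by metis
    qed
  qed
  define h where "h X = ev (SOME w. w \<in> X)" for X
  have h_class: "h (free_product_rel V G `` {w}) = ev w" if "w \<in> words V G" for w
  proof -
    have "w \<in> free_product_rel V G `` {w}"
      using equiv_class_self[OF equiv_free_product_rel that] .
    then have "(SOME t. t \<in> free_product_rel V G `` {w}) \<in> free_product_rel V G `` {w}"
      by (rule someI)
    then show ?thesis using ev_rel by (force simp: h_def)
  qed
  have "h \<in> hom (free_product V G) H"
  proof (rule homI)
    fix X assume "X \<in> carrier (free_product V G)"
    then show "h X \<in> carrier H" by (auto elim!: fp_carrierE simp: h_class)
  next
    fix X Y assume "X \<in> carrier (free_product V G)" "Y \<in> carrier (free_product V G)"
    then show "h (X \<otimes>\<^bsub>free_product V G\<^esub> Y) = h X \<otimes>\<^bsub>H\<^esub> h Y"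
      by (auto elim!: fp_carrierE simp: h_class fp_mult)
  qed
  moreover have "\<forall>u\<in>V. \<forall>a\<in>carrier (G u). h (free_product_incl V G (u, a)) = f u a"
    by (simp add: free_product_incl_def h_class)
  ultimately show ?thesis by blast
qed

lemma free_product_universal_unique:
  assumes "group H" "h \<in> hom (free_product V G) H" "h' \<in> hom (free_product V G) H"
    and "\<forall>u\<in>V. group (G u)"
    and "\<And>u a. u \<in> V \<Longrightarrow> a \<in> carrier (G u)
      \<Longrightarrow> h (free_product_incl V G (u, a)) = h' (free_product_incl V G (u, a))"
    and "X \<in> carrier (free_product V G)"
  shows "h X = h' X"
proof -
  have one: "h \<one>\<^bsub>free_product V G\<^esub> = h' \<one>\<^bsub>free_product V G\<^esub>"
    using hom_one[OF assms(2) group_free_product[OF assms(4)] assms(1)]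
      hom_one[OF assms(3) group_free_product[OF assms(4)] assms(1)] by simp
  have "h (free_product_rel V G `` {w}) = h' (free_product_rel V G `` {w})"
    if "w \<in> words V G" for w
    using that
  proof (induction w)
    case Nil
    then show ?case using one by (simp add: fp_one)
  next
    case (Cons s w)
    obtain u a where s: "s = (u, a)" by force
    then have ua: "u \<in> V" "a \<in> carrier (G u)" "w \<in> words V G" using Cons.prems by auto
    then have "free_product_rel V G `` {s # w}
        = free_product_incl V G (u, a) \<otimes>\<^bsub>free_product V G\<^esub> free_product_rel V G `` {w}"
      using fp_mult[of "[(u, a)]" V G w] by (simp add: s free_product_incl_def)
    moreover have "free_product_incl V G (u, a) \<in> carrier (free_product V G)"
      using ua by (simp add: free_product_incl_def fp_class_in_carrier)
    ultimately show ?case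
      using ua Cons.IH assms(5) fp_class_in_carrier[OF ua(3)]
      by (simp add: hom_mult[OF assms(2)] hom_mult[OF assms(3)])
  qed
  then show ?thesis using assms(6) by (auto elim: fp_carrierE)
qed

lemma alternating_in_words:
  "\<lbrakk>u \<in> V; v \<in> V; a \<in> carrier (G u); b \<in> carrier (G v)\<rbrakk>
    \<Longrightarrow> alternating (u, a) (v, b) k \<in> words V G"
  by (induction k arbitrary: u v a b) auto

lemma periagroup_relators_subset:
  assumes "periagroup_data V E lab G"
  shows "periagroup_relators V E lab G \<subseteq> carrier (free_product V G)"
proof -
  interpret F: group "free_product V G"
    using assms by (intro group_free_product) (simp add: periagroup_data_def)
  have V: "u \<in> V \<and> v \<in> V" if "{u, v} \<in> E" for u v
    using assms that by (fastforce simp: periagroup_data_def simplicial_graph_def doubleton_eq_iff)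
  show ?thesis
    unfolding periagroup_relators_def
    by (auto simp: free_product_val_eq alternating_in_words fp_class_in_carrier dest!: V)
qed

lemma (in group) normal_closure_normal:
  assumes "R \<subseteq> carrier G"
  shows "normal_closure G R \<lhd> G"
  unfolding normal_closure_def
proof (rule normal_generateI)
  show "{x \<otimes> r \<otimes> inv x | x r. x \<in> carrier G \<and> r \<in> R} \<subseteq> carrier G"
    using assms by auto
next
  fix h y assume "h \<in> {x \<otimes> r \<otimes> inv x | x r. x \<in> carrier G \<and> r \<in> R}" and y: "y \<in> carrier G"
  then obtain x r where xr: "x \<in> carrier G" "r \<in> R" "h = x \<otimes> r \<otimes> inv x" by blast
  then have "y \<otimes> h \<otimes> inv y = (y \<otimes> x) \<otimes> r \<otimes> inv (y \<otimes> x)"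
    using assms y by (auto simp: m_assoc inv_mult_group subset_iff)
  then show "y \<otimes> h \<otimes> inv y \<in> {x \<otimes> r \<otimes> inv x | x r. x \<in> carrier G \<and> r \<in> R}"
    using xr y by blast
qed

lemma periagroup_kernel_normal:
  assumes "periagroup_data V E lab G"
  shows "periagroup_kernel V E lab G \<lhd> free_product V G"
  unfolding periagroup_kernel_def
  using assms by (intro group.normal_closure_normal group_free_product periagroup_relators_subset)
    (auto simp: periagroup_data_def)

lemma group_periagroup:
  assumes "periagroup_data V E lab G"
  shows "group (periagroup V E lab G)"
  unfolding periagroup_def
  by (rule normal.factorgroup_is_group[OF periagroup_kernel_normal[OF assms]])

end

theory Submission
  imports Defs Complex_Main
begin

text \<open>To a word \<open>s\<^sub>1 \<dots> s\<^sub>n\<close> attach its walls, the conjugates of the vertex-groups of the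
  \<open>s\<^sub>i\<close> by the prefixes \<open>s\<^sub>1 \<dots> s\<^sub>i\<^sub>-\<^sub>1\<close>, each with the corresponding conjugate of \<open>s\<^sub>i\<close>. For every
  subgroup, the product of the elements attached to it depends only on the group element
  represented. So a word whose walls are pairwise distinct, with non-trivial elements, has minimal
  length, and two syllables sharing a wall can be merged, which is an exchange condition. As in the
  theorem of Tits and Matsumoto on Coxeter groups, induction on the length then connects two such
  words for the same element by dihedral relations. This needs that the vertex-groups embed and that
  their pairs generate nothing smaller than expected, which is read off a linear
  representation generalising the geometric representation of a Coxeter group.\<close>

text \<open>Equality in the quotient yields chains of moves in both directions, whereas a
  graphically reduced word is tested only against forward moves; tautness, a condition on the word
  alone, bridges the two. In a Coxeter group one counts modulo 2 how often a wall is crossed. For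
  arbitrary vertex-groups this parity becomes a product in the group, so the order of the factors
  matters and every relation has to respect it. The representation must serve arbitrary
  vertex-groups too: a label above 2 forces order two, so the trigonometry concerns reflections
  only; label 2 asks just for commuting actions; non-adjacent vertices are treated by ping-pong.
  Full faithfulness is never claimed. What is extracted is that a single vertex-group embeds, and
  that an alternating word starting over \<open>v\<close>, of length below the label (of any length
  without an edge), leaves \<open>base\<close> on the identity side of \<open>u\<close>.\<close>

lemma alternating_Suc_snoc:
  "alternating a b (Suc k) = alternating a b k @ [if even k then a else b]"
proof (induction k arbitrary: a b)
  case (Suc k)
  have "alternating a b (Suc (Suc k)) = a # alternating b a (Suc k)" by simp
  also have "\<dots> = a # alternating b a k @ [if even k then b else a]" by (simp only: Suc.IH)
  finally show ?case by simp
qed simp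

lemma length_alternating [simp]: "length (alternating a b k) = k"
  by (induction k arbitrary: a b) auto

subsection \<open>Equality in the periagroup\<close>

locale periagroup_presentation =
  fixes V :: "'v set" and E :: "'v set set" and lab :: "'v set \<Rightarrow> nat"
    and G :: "'v \<Rightarrow> ('a, 'b) monoid_scheme"
  assumes data: "periagroup_data V E lab G"
begin

abbreviation W where "W \<equiv> words V G"
abbreviation F where "F \<equiv> free_product V G"
abbreviation K where "K \<equiv> periagroup_kernel V E lab G"
abbreviation X where "X \<equiv> periagroup V E lab G"
abbreviation val where "val \<equiv> periagroup_val V E lab G"
abbreviation move where "move \<equiv> elementary_move V E lab G"
abbreviation cls where "cls w \<equiv> free_product_rel V G `` {w}"

lemma group_G: "u \<in> V \<Longrightarrow> group (G u)"
  using data by (simp add: periagroup_data_def)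

lemma one_G [simp]: "u \<in> V \<Longrightarrow> \<one>\<^bsub>G u\<^esub> \<in> carrier (G u)"
  by (simp add: group_G group.is_monoid monoid.one_closed)

lemma mult_G [simp]:
  "\<lbrakk>u \<in> V; a \<in> carrier (G u); b \<in> carrier (G u)\<rbrakk> \<Longrightarrow> a \<otimes>\<^bsub>G u\<^esub> b \<in> carrier (G u)"
  by (simp add: group_G group.is_monoid monoid.m_closed)

lemma inv_G [simp]: "\<lbrakk>u \<in> V; a \<in> carrier (G u)\<rbrakk> \<Longrightarrow> inv\<^bsub>G u\<^esub> a \<in> carrier (G u)"
  by (simp add: group_G)

lemma edge_vertices: "{u, v} \<in> E \<Longrightarrow> u \<in> V \<and> v \<in> V \<and> u \<noteq> v"
  using data
  by (fastforce simp: periagroup_data_def simplicial_graph_def doubleton_eq_iff)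

lemma label_ge_2: "e \<in> E \<Longrightarrow> 2 \<le> lab e"
  using data by (simp add: periagroup_data_def)

lemma order_2: "\<lbrakk>{u, v} \<in> E; 2 < lab {u, v}\<rbrakk> \<Longrightarrow> order (G u) = 2 \<and> order (G v) = 2"
  using data by (simp add: periagroup_data_def)

lemma group_X: "group X"
  by (rule group_periagroup[OF data])

lemma group_F: "group F"
  using data by (intro group_free_product) (simp add: periagroup_data_def)

lemma K_normal: "K \<lhd> F"
  by (rule periagroup_kernel_normal[OF data])

lemma cls_eq_iff: "\<lbrakk>w \<in> W; w' \<in> W\<rbrakk> \<Longrightarrow> cls w = cls w' \<longleftrightarrow> (w, w') \<in> free_product_rel V G"
  by (rule eq_equiv_class_iff[OF equiv_free_product_rel])

lemma val_eq: "w \<in> W \<Longrightarrow> val w = K #>\<^bsub>F\<^esub> cls w"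
proof (induction w)
  case Nil
  have "K #>\<^bsub>F\<^esub> \<one>\<^bsub>F\<^esub> = K"
    using K_normal group_F
    by (intro group.coset_mult_one) (auto simp: normal_imp_subgroup subgroup.subset)
  then show ?case
    by (simp add: periagroup_val_def periagroup_def FactGroup_def fp_one)
next
  case (Cons s w)
  obtain u a where s: "s = (u, a)" by force
  have "cls [s] \<in> carrier F" "cls w \<in> carrier F"
    using Cons.prems by (auto simp: s intro!: fp_class_in_carrier)
  then have "(K #>\<^bsub>F\<^esub> cls [s]) <#>\<^bsub>F\<^esub> (K #>\<^bsub>F\<^esub> cls w) = K #>\<^bsub>F\<^esub> cls (s # w)"
    using normal.rcos_sum[OF K_normal] fp_mult[of "[s]" V G w] Cons.prems by (simp add: s)
  then show ?case
    using Cons by (auto simp: s periagroup_val_def periagroup_def FactGroup_def periagroup_incl_def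
        free_product_incl_def)
qed

lemma val_closed [simp]: "w \<in> W \<Longrightarrow> val w \<in> carrier X"
  by (auto simp: val_eq periagroup_def FactGroup_def RCOSETS_def intro!: fp_class_in_carrier)

lemma val_Nil [simp]: "val [] = \<one>\<^bsub>X\<^esub>"
  by (simp add: periagroup_val_def)

lemma val_append: "\<lbrakk>x \<in> W; y \<in> W\<rbrakk> \<Longrightarrow> val (x @ y) = val x \<otimes>\<^bsub>X\<^esub> val y"
  using normal.rcos_sum[OF K_normal fp_class_in_carrier fp_class_in_carrier, of x y] fp_mult[of x V G y]
  by (simp add: val_eq) (simp add: periagroup_def FactGroup_def)

lemma val_Cons: "s # w \<in> W \<Longrightarrow> val (s # w) = val [s] \<otimes>\<^bsub>X\<^esub> val w"
  using val_append[of "[s]" w] by (cases s) auto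

lemma move_words: "move s t \<Longrightarrow> s \<in> W \<and> t \<in> W"
  by (auto simp: elementary_move_def elim!: reduction_move.cases fusion_move.cases
      dihedral_move.cases intro!: alternating_in_words dest!: edge_vertices)

section \<open>From equality in the quotient to chains of moves\<close>

lemma move_context:
  assumes "move s t" "p \<in> W" "q \<in> W"
  shows "move (p @ s @ q) (p @ t @ q)"
proof -
  have "dihedral_move V E lab G (p @ s @ q) (p @ t @ q)" if "dihedral_move V E lab G s t"
    using that
  proof cases
    case (1 u v a b x y)
    then show ?thesis
      using dihedral_move.intros[of u v E a G b "p @ x" V "y @ q" lab] assms by simp
  qed
  then show ?thesis
    using assms fp_move_context[of V G s t p q] by (auto simp: elementary_move_def)
qed

lemma equivclp_move_context:
  assumes "equivclp move s t" "p \<in> W" "q \<in> W"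
  shows "equivclp move (p @ s @ q) (p @ t @ q)"
  using assms(1)
proof (induction rule: equivclp_induct)
  case base
  then show ?case by simp
next
  case (step y z)
  then have "move (p @ y @ q) (p @ z @ q) \<or> move (p @ z @ q) (p @ y @ q)"
    using move_context[OF _ assms(2,3)] by blast
  with step.IH show ?case by (rule equivclp_into_equivclp)
qed

lemma free_product_rel_imp_equivclp_move:
  assumes "(s, t) \<in> free_product_rel V G"
  shows "equivclp move s t"
proof -
  have "equivclp (\<lambda>s t. reduction_move V G s t \<or> fusion_move V G s t) s t"
    using assms by (simp add: free_product_rel_def)
  then show ?thesis
  proof (induction rule: equivclp_induct)
    case (step y z)
    then have "move y z \<or> move z y" by (auto simp: elementary_move_def)
    with step.IH show ?case by (rule equivclp_into_equivclp)
  qed simp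
qed

lemma inv_cls:
  assumes "w \<in> W"
  obtains w' where "w' \<in> W" "inv\<^bsub>F\<^esub> (cls w) = cls w'"
    "equivclp move (w' @ w) []" "equivclp move (w @ w') []"
proof -
  interpret F: group F by (rule group_F)
  have "inv\<^bsub>F\<^esub> (cls w) \<in> carrier F" using assms by (simp add: fp_class_in_carrier)
  then obtain w' where w': "w' \<in> W" "inv\<^bsub>F\<^esub> (cls w) = cls w'" by (rule fp_carrierE)
  have "cls w' \<otimes>\<^bsub>F\<^esub> cls w = cls []" "cls w \<otimes>\<^bsub>F\<^esub> cls w' = cls []"
    using assms by (simp_all add: w'(2)[symmetric] fp_class_in_carrier fp_one[symmetric])
  then have "(w' @ w, []) \<in> free_product_rel V G" "(w @ w', []) \<in> free_product_rel V G"
    using assms w' by (simp_all add: fp_mult cls_eq_iff)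
  then show ?thesis using that w' free_product_rel_imp_equivclp_move by blast
qed

text \<open>A single dihedral relation applied to the front half turns a relator into a word
  followed by its inverse, which collapses by reductions and fusions read in either
  direction.\<close>

lemma relator_move_trivial:
  assumes "r \<in> periagroup_relators V E lab G"
  shows "\<exists>z\<in>W. r = cls z \<and> equivclp move z []"
proof -
  obtain u v a b where r: "r = free_product_val V G (alternating (u, a) (v, b) (lab {u, v}))
      \<otimes>\<^bsub>F\<^esub> inv\<^bsub>F\<^esub> (free_product_val V G (alternating (v, b) (u, a) (lab {u, v})))"
    and uv: "{u, v} \<in> E" "a \<in> carrier (G u) - {\<one>\<^bsub>G u\<^esub>}" "b \<in> carrier (G v) - {\<one>\<^bsub>G v\<^esub>}"
    using assms by (auto simp: periagroup_relators_def)
  let ?s = "alternating (u, a) (v, b) (lab {u, v})"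
  let ?t = "alternating (v, b) (u, a) (lab {u, v})"
  have st: "?s \<in> W" "?t \<in> W" using uv edge_vertices by (auto intro!: alternating_in_words)
  obtain t' where t': "t' \<in> W" "inv\<^bsub>F\<^esub> (cls ?t) = cls t'" "equivclp move (?t @ t') []"
    using inv_cls[OF st(2)] by blast
  have "dihedral_move V E lab G ([] @ ?s @ t') ([] @ ?t @ t')"
    by (rule dihedral_move.intros) (use uv t' in auto)
  then have "equivclp move (?s @ t') (?t @ t')"
    by (simp add: elementary_move_def r_into_equivclp)
  then have "equivclp move (?s @ t') []" using t'(3) by (rule equivclp_trans)
  moreover have "r = cls (?s @ t')" using st t' by (simp add: r free_product_val_eq fp_mult)
  ultimately show ?thesis using st t' by (intro bexI[of _ "?s @ t'"]) auto
qed

lemma relator_conjugate_move_trivial: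
  assumes "h \<in> {x \<otimes>\<^bsub>F\<^esub> r \<otimes>\<^bsub>F\<^esub> inv\<^bsub>F\<^esub> x |x r. x \<in> carrier F \<and> r \<in> periagroup_relators V E lab G}"
  shows "\<exists>z\<in>W. h = cls z \<and> equivclp move z []"
proof -
  obtain x r where x: "x \<in> carrier F" "r \<in> periagroup_relators V E lab G"
    "h = x \<otimes>\<^bsub>F\<^esub> r \<otimes>\<^bsub>F\<^esub> inv\<^bsub>F\<^esub> x" using assms by blast
  obtain y where y: "y \<in> W" "x = cls y" using x(1) by (rule fp_carrierE)
  obtain y' where y': "y' \<in> W" "inv\<^bsub>F\<^esub> (cls y) = cls y'" "equivclp move (y @ y') []"
    using inv_cls[OF y(1)] by blast
  obtain z where z: "z \<in> W" "r = cls z" "equivclp move z []"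
    using relator_move_trivial[OF x(2)] by blast
  have "equivclp move (y @ z @ y') (y @ [] @ y')"
    using z y y' by (intro equivclp_move_context)
  then have "equivclp move (y @ z @ y') []" using y'(3) by (auto intro: equivclp_trans)
  then show ?thesis using x y y' z by (intro bexI[of _ "y @ z @ y'"]) (auto simp: fp_mult)
qed

lemma kernel_move_trivial:
  assumes "k \<in> K"
  shows "\<exists>z\<in>W. k = cls z \<and> equivclp move z []"
  using assms unfolding periagroup_kernel_def normal_closure_def
proof (induction rule: generate.induct)
  case one
  then show ?case by (intro bexI[of _ "[]"]) (simp_all add: fp_one)
next
  case (incl h)
  then show ?case by (rule relator_conjugate_move_trivial)
next
  case (inv h)
  obtain z where z: "z \<in> W" "h = cls z" "equivclp move z []" using relator_conjugate_move_trivial[OF inv] by blast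
  obtain z' where z': "z' \<in> W" "inv\<^bsub>F\<^esub> (cls z) = cls z'" "equivclp move (z' @ z) []"
    using inv_cls[OF z(1)] by blast
  have "equivclp move (z' @ z @ []) (z' @ [] @ [])" using z z' by (intro equivclp_move_context) auto
  then have "equivclp move z' []" using z'(3) by (auto intro: equivclp_sym equivclp_trans)
  then show ?case using z z' by auto
next
  case (eng h1 h2)
  then obtain z1 z2 where z: "z1 \<in> W" "h1 = cls z1" "equivclp move z1 []"
    "z2 \<in> W" "h2 = cls z2" "equivclp move z2 []" by blast
  have "equivclp move ([] @ z1 @ z2) ([] @ [] @ z2)" using z by (intro equivclp_move_context) auto
  then have "equivclp move (z1 @ z2) []" using z by (auto intro: equivclp_trans)
  then show ?case using z by (intro bexI[of _ "z1 @ z2"]) (auto simp: fp_mult)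
qed

lemma val_eq_imp_equivclp_move:
  assumes "w \<in> W" "w' \<in> W" "val w = val w'"
  shows "equivclp move w w'"
proof -
  interpret F: group F by (rule group_F)
  have "cls w \<in> K #>\<^bsub>F\<^esub> cls w"
    using F.rcos_self fp_class_in_carrier[OF assms(1)] normal_imp_subgroup[OF K_normal] by blast
  then have "cls w \<in> K #>\<^bsub>F\<^esub> cls w'" using assms by (simp add: val_eq)
  then obtain k where k: "k \<in> K" "cls w = k \<otimes>\<^bsub>F\<^esub> cls w'" by (auto simp: r_coset_def)
  then obtain z where z: "z \<in> W" "k = cls z" "equivclp move z []"
    using kernel_move_trivial by blast
  have "cls w = cls (z @ w')" using k z assms by (simp add: fp_mult)
  then have "equivclp move w (z @ w')"
    using assms z cls_eq_iff free_product_rel_imp_equivclp_move by simp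
  moreover have "equivclp move ([] @ z @ w') ([] @ [] @ w')"
    using z assms by (intro equivclp_move_context) auto
  ultimately show ?thesis by (auto intro: equivclp_trans)
qed

text \<open>The door through which both invariants enter: a quantity constant along single moves
  depends only on the element represented. It is used for \<open>act\<close> and for the holonomy of
  the walls.\<close>

lemma val_eq_invariant:
  assumes "w \<in> W" "w' \<in> W" "val w = val w'"
    and inv: "\<And>s t. move s t \<Longrightarrow> \<phi> s = \<phi> t"
  shows "\<phi> w = \<phi> w'"
  using val_eq_imp_equivclp_move[OF assms(1-3)]
proof (induction rule: equivclp_induct)
  case (step y z)
  then show ?case using inv by metis
qed simp

section \<open>Moves preserve the element represented\<close>

lemma val_alternating:
  assumes "{u, v} \<in> E" "a \<in> carrier (G u) - {\<one>\<^bsub>G u\<^esub>}" "b \<in> carrier (G v) - {\<one>\<^bsub>G v\<^esub>}"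
  shows "val (alternating (u, a) (v, b) (lab {u, v})) = val (alternating (v, b) (u, a) (lab {u, v}))"
proof -
  interpret F: group F by (rule group_F)
  let ?s = "alternating (u, a) (v, b) (lab {u, v})"
  let ?t = "alternating (v, b) (u, a) (lab {u, v})"
  have st: "?s \<in> W" "?t \<in> W" using assms edge_vertices by (auto intro!: alternating_in_words)
  let ?r = "cls ?s \<otimes>\<^bsub>F\<^esub> inv\<^bsub>F\<^esub> cls ?t"
  have r: "?r \<in> periagroup_relators V E lab G"
    using assms st unfolding periagroup_relators_def by (force simp: free_product_val_eq)
  have c: "cls ?s \<in> carrier F" "cls ?t \<in> carrier F" using st by (auto intro: fp_class_in_carrier)
  have "\<one>\<^bsub>F\<^esub> \<otimes>\<^bsub>F\<^esub> ?r \<otimes>\<^bsub>F\<^esub> inv\<^bsub>F\<^esub> \<one>\<^bsub>F\<^esub> \<in> K"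
    unfolding periagroup_kernel_def normal_closure_def using r by (intro generate.incl) blast
  then have "?r \<in> K" using c by simp
  have K: "subgroup K F" by (rule normal_imp_subgroup[OF K_normal])
  have "K #>\<^bsub>F\<^esub> ?r = K" using c by (intro F.coset_join2[OF _ K \<open>?r \<in> K\<close>]) auto
  then have "K #>\<^bsub>F\<^esub> cls ?s = K #>\<^bsub>F\<^esub> cls ?t"
    by (rule F.coset_mult_inv1[OF _ c subgroup.subset[OF K]])
  then show ?thesis using st by (simp add: val_eq)
qed

lemma val_fp_move:
  assumes "reduction_move V G s t \<or> fusion_move V G s t" "s \<in> W" "t \<in> W"
  shows "val s = val t"
proof -
  have "(s, t) \<in> free_product_rel V G"
    using assms by (auto simp: free_product_rel_def intro!: r_into_equivclp)
  then have "cls s = cls t" using assms cls_eq_iff by blast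
  then show ?thesis using assms by (simp add: val_eq)
qed

lemma val_move:
  assumes "move s t"
  shows "val s = val t"
proof -
  have "val s = val t" if "dihedral_move V E lab G s t"
    using that
  proof cases
    case (1 u v a b x y)
    then have "alternating (u, a) (v, b) (lab {u, v}) \<in> W" "alternating (v, b) (u, a) (lab {u, v}) \<in> W"
      using move_words[OF assms] by auto
    then show ?thesis using 1 val_alternating[of u v a b] by (simp add: val_append)
  qed
  then show ?thesis
    using assms move_words[OF assms] val_fp_move unfolding elementary_move_def by blast
qed

lemma val_one [simp]: "u \<in> V \<Longrightarrow> val [(u, \<one>\<^bsub>G u\<^esub>)] = \<one>\<^bsub>X\<^esub>"
  using val_fp_move[of "[] @ [(u, \<one>\<^bsub>G u\<^esub>)] @ []" "[] @ []"] reduction_move.intros[of u V "[]" G "[]"] by simp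

lemma val_mult:
  "\<lbrakk>u \<in> V; a \<in> carrier (G u); b \<in> carrier (G u)\<rbrakk>
    \<Longrightarrow> val [(u, a \<otimes>\<^bsub>G u\<^esub> b)] = val [(u, a)] \<otimes>\<^bsub>X\<^esub> val [(u, b)]"
  using val_fp_move[of "[] @ [(u, a), (u, b)] @ []" "[] @ [(u, a \<otimes>\<^bsub>G u\<^esub> b)] @ []"]
    fusion_move.intros[of u V a G b "[]" "[]"] val_append[of "[(u, a)]" "[(u, b)]"] by simp

lemma val_inv:
  "\<lbrakk>u \<in> V; a \<in> carrier (G u)\<rbrakk> \<Longrightarrow> val [(u, inv\<^bsub>G u\<^esub> a)] = inv\<^bsub>X\<^esub> (val [(u, a)])"
  using val_mult[of u "inv\<^bsub>G u\<^esub> a" a] group.l_inv[OF group_G]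
  by (intro group.inv_equality[OF group_X, symmetric]) auto

subsection \<open>A linear representation\<close>

text \<open>This is minus twice the bilinear form of a Coxeter system. A missing edge counts as
  label infinity, hence the limit value 2; label 2 gives 0.\<close>

definition coupling :: "'v \<Rightarrow> 'v \<Rightarrow> real" where
  "coupling u r = (if {u, r} \<in> E then 2 * cos (pi / real (lab {u, r})) else 2)"

text \<open>For vertex-groups of order two, \<open>f(u, \<one>) - f(u, a)\<close> is the value at the simple root of \<open>u\<close> in
  the dual of Tits' geometric representation. A larger vertex-group permutes its own
  coordinates regularly instead of changing a sign.\<close>

definition syllable_act :: "'v \<times> 'a \<Rightarrow> ('v \<times> 'a \<Rightarrow> real) \<Rightarrow> 'v \<times> 'a \<Rightarrow> real" where
  "syllable_act s f p =
     (let u = fst s; a = snd s; r = fst p; x = snd p in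
      if r = u then (if x \<in> carrier (G u) then f (u, inv\<^bsub>G u\<^esub> a \<otimes>\<^bsub>G u\<^esub> x) else f p)
      else f p + (if x = \<one>\<^bsub>G r\<^esub> then coupling u r * (f (u, \<one>\<^bsub>G u\<^esub>) - f (u, inv\<^bsub>G u\<^esub> a)) else 0))"

abbreviation act where "act \<equiv> foldr syllable_act"

text \<open>A point inside the fundamental chamber: over every vertex, its value at the identity
  exceeds each other value by 1.\<close>

definition base :: "'v \<times> 'a \<Rightarrow> real" where
  "base p = (if snd p = \<one>\<^bsub>G (fst p)\<^esub> then 1 else 0)"

lemma syllable_act_same: "x \<in> carrier (G u) \<Longrightarrow> syllable_act (u, a) f (u, x) = f (u, inv\<^bsub>G u\<^esub> a \<otimes>\<^bsub>G u\<^esub> x)"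
  by (simp add: syllable_act_def)

lemma syllable_act_other: "r \<noteq> u \<Longrightarrow> syllable_act (u, a) f (r, x) =
    f (r, x) + (if x = \<one>\<^bsub>G r\<^esub> then coupling u r * (f (u, \<one>\<^bsub>G u\<^esub>) - f (u, inv\<^bsub>G u\<^esub> a)) else 0)"
  by (simp add: syllable_act_def)

lemma coupling_commute: "coupling u v = coupling v u"
  by (simp add: coupling_def insert_commute)

lemma syllable_act_one:
  assumes "u \<in> V"
  shows "syllable_act (u, \<one>\<^bsub>G u\<^esub>) f = f"
proof -
  interpret Gu: group "G u" by (rule group_G[OF assms])
  show ?thesis by (auto simp: syllable_act_def fun_eq_iff Let_def)
qed

text \<open>The corrections at the identity of another vertex telescope: \<open>b\<close> adds a
  multiple of \<open>f(u,1) - f(u,b^-1)\<close>, then \<open>a\<close> adds the same multiple of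
  \<open>f(u,b^-1) - f(u,b^-1 a^-1)\<close>.\<close>

lemma syllable_act_mult:
  assumes "u \<in> V" "a \<in> carrier (G u)" "b \<in> carrier (G u)"
  shows "syllable_act (u, a) (syllable_act (u, b) f) = syllable_act (u, a \<otimes>\<^bsub>G u\<^esub> b) f"
proof -
  interpret Gu: group "G u" by (rule group_G[OF assms(1)])
  show ?thesis
    using assms(2,3)
    by (auto simp: syllable_act_def fun_eq_iff Let_def Gu.inv_mult_group Gu.m_assoc algebra_simps)
qed

text \<open>With coupling 0 neither syllable changes the coordinates over the other's vertex, and
  each correction at a third vertex reads only the coordinates over the acting vertex.\<close>

lemma syllable_act_commute:
  assumes "u \<noteq> v" "coupling u v = 0" "u \<in> V" "v \<in> V" "a \<in> carrier (G u)" "b \<in> carrier (G v)"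
  shows "syllable_act (u, a) (syllable_act (v, b) f) = syllable_act (v, b) (syllable_act (u, a) f)"
proof -
  have c: "coupling v u = 0" using assms(2) by (simp add: coupling_commute)
  have i: "inv\<^bsub>G u\<^esub> a \<in> carrier (G u)" "inv\<^bsub>G v\<^esub> b \<in> carrier (G v)" using assms by auto
  show ?thesis
  proof
    fix p :: "'v \<times> 'a"
    obtain r x where p: "p = (r, x)" by force
    consider "r = u" | "r = v" | "r \<noteq> u" "r \<noteq> v" by blast
    then show "syllable_act (u, a) (syllable_act (v, b) f) p = syllable_act (v, b) (syllable_act (u, a) f) p"
    proof cases
      case 1
      then show ?thesis using assms(1,2) c by (simp add: p syllable_act_def Let_def)
    next
      case 2
      then show ?thesis using assms(1,2) c by (simp add: p syllable_act_def Let_def)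
    next
      case 3
      then show ?thesis using assms(1,2) c i by (simp add: p syllable_act_other)
    qed
  qed
qed

section \<open>Reflections attached to vertex-groups of order two\<close>

lemma order_2_nontrivial:
  assumes "u \<in> V" "order (G u) = 2" "a \<in> carrier (G u)" "a \<noteq> \<one>\<^bsub>G u\<^esub>"
  shows "carrier (G u) = {\<one>\<^bsub>G u\<^esub>, a}" "inv\<^bsub>G u\<^esub> a = a"
proof -
  interpret Gu: group "G u" by (rule group_G[OF assms(1)])
  obtain x y where xy: "carrier (G u) = {x, y}"
    using assms(2) card_2_iff unfolding order_def by metis
  then show c: "carrier (G u) = {\<one>\<^bsub>G u\<^esub>, a}" using Gu.one_closed assms by auto
  have "inv\<^bsub>G u\<^esub> a \<noteq> \<one>\<^bsub>G u\<^esub>" using assms Gu.inv_eq_1_iff by blast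
  then show "inv\<^bsub>G u\<^esub> a = a" using c Gu.inv_closed[OF assms(3)] by auto
qed

definition coroot :: "'v \<Rightarrow> 'a \<Rightarrow> ('v \<times> 'a \<Rightarrow> real) \<Rightarrow> real" where
  "coroot u a f = f (u, \<one>\<^bsub>G u\<^esub>) - f (u, a)"

text \<open>Chosen so that a syllable of order two acts as the reflection
  \<open>f - coroot u a f * root u a\<close>. The pairings of coroots with roots are then 2 and
  minus the couplings, the entries of a Cartan matrix.\<close>

definition root :: "'v \<Rightarrow> 'a \<Rightarrow> 'v \<times> 'a \<Rightarrow> real" where
  "root u a p = (if fst p = u then (if snd p = \<one>\<^bsub>G u\<^esub> then 1 else if snd p = a then -1 else 0)
     else if snd p = \<one>\<^bsub>G (fst p)\<^esub> then - coupling u (fst p) else 0)"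

lemma syllable_act_order_2:
  assumes "u \<in> V" "order (G u) = 2" "a \<in> carrier (G u)" "a \<noteq> \<one>\<^bsub>G u\<^esub>"
  shows "syllable_act (u, a) f p = f p - coroot u a f * root u a p"
proof -
  interpret Gu: group "G u" by (rule group_G[OF assms(1)])
  have "a \<otimes>\<^bsub>G u\<^esub> a = \<one>\<^bsub>G u\<^esub>"
    using Gu.l_inv[OF assms(3)] order_2_nontrivial(2)[OF assms] by simp
  then show ?thesis
    using assms(4) order_2_nontrivial[OF assms] by (cases p) (auto simp: syllable_act_def coroot_def root_def Let_def)
qed

lemma coroot_diff: "coroot u a (\<lambda>p. f p - c * g p) = coroot u a f - c * coroot u a g"
  by (simp add: coroot_def algebra_simps)

lemma coroot_root: "a \<noteq> \<one>\<^bsub>G u\<^esub> \<Longrightarrow> coroot u a (root u a) = 2"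
  by (simp add: coroot_def root_def)

lemma coroot_root_other:
  "\<lbrakk>u \<noteq> v; b \<noteq> \<one>\<^bsub>G v\<^esub>\<rbrakk> \<Longrightarrow> coroot v b (root u a) = - coupling u v"
  by (simp add: coroot_def root_def)

text \<open>The recurrence \<open>x\<^sub>k\<^sub>+\<^sub>1 = 2 cos t x\<^sub>k - x\<^sub>k\<^sub>-\<^sub>1\<close> is solved by sines. The right-hand
  sides depend on the parity of \<open>k\<close> because the last letter of the word, which acts first, does.\<close>

lemma coroot_alternating:
  assumes "{u, v} \<in> E" "order (G u) = 2" "order (G v) = 2"
    "a \<in> carrier (G u) - {\<one>\<^bsub>G u\<^esub>}" "b \<in> carrier (G v) - {\<one>\<^bsub>G v\<^esub>}"
  defines "t \<equiv> pi / real (lab {u, v})"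
  shows "sin t * coroot u a (act (alternating (v, b) (u, a) k) f)
      = sin ((real k + 1) * t) * (if even k then coroot u a f else coroot v b f)
        + sin (real k * t) * (if even k then coroot v b f else coroot u a f)"
    and "sin t * coroot v b (act (alternating (v, b) (u, a) k) f)
      = - sin (real k * t) * (if even k then coroot u a f else coroot v b f)
        - sin ((real k - 1) * t) * (if even k then coroot v b f else coroot u a f)"
  using assms(1-5) unfolding t_def
proof (induction k arbitrary: u v a b)
  case 0
  {
    case 1
    then show ?case by simp
  next
    case 2
    then show ?case by simp
  }
next
  case (Suc k)
  {
    fix u v a b
    assume A: "{u, v} \<in> E" "order (G u) = 2" "order (G v) = 2"
      "a \<in> carrier (G u) - {\<one>\<^bsub>G u\<^esub>}" "b \<in> carrier (G v) - {\<one>\<^bsub>G v\<^esub>}"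
    let ?t = "pi / real (lab {u, v})"
    let ?g = "act (alternating (u, a) (v, b) k) f"
    let ?h = "act (alternating (v, b) (u, a) (Suc k)) f"
    have uv: "u \<in> V" "v \<in> V" "u \<noteq> v" using A edge_vertices by auto
    have sw: "{v, u} = {u, v}" by auto
    have h: "?h = (\<lambda>p. ?g p - coroot v b ?g * root v b p)"
      using A uv by (simp add: fun_eq_iff syllable_act_order_2)
    have hv: "coroot v b ?h = - coroot v b ?g"
      using A by (simp only: h coroot_diff) (simp add: coroot_root)
    have hu: "coroot u a ?h = coroot u a ?g + 2 * cos ?t * coroot v b ?g"
      using A uv by (simp only: h coroot_diff) (simp add: coroot_root_other coupling_def sw)
    note IH = Suc.IH[of v u b a, unfolded sw, OF A(1,3,2,5,4)]
    have trig: "sin (x + t) + sin (x - t) = 2 * cos t * sin x" for x t :: real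
      by (simp add: sin_add sin_diff)
    have mult: "(real (Suc k) + 1) * t = (real k + 1) * t + t" "real k * t = (real k + 1) * t - t"
      "real (Suc k) * t = real k * t + t" "(real k - 1) * t = real k * t - t" for t
      by (simp_all add: algebra_simps)
    have sw_sum: "sin ((real (Suc k) + 1) * ?t) + sin (real k * ?t)
        = 2 * cos ?t * sin ((real k + 1) * ?t)"
      unfolding mult(1,2) by (rule trig)
    have sw_sum': "sin (real (Suc k) * ?t) + sin ((real k - 1) * ?t)
        = 2 * cos ?t * sin (real k * ?t)"
      unfolding mult(3,4) by (rule trig)
    \<comment> \<open>\<open>P\<close> and \<open>Q\<close> name the two initial coroots so that the
      swap of \<open>u\<close> and \<open>v\<close> in the induction hypothesis cancels the change
      of parity from \<open>k\<close> to \<open>Suc k\<close>.\<close>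
    define P where "P = (if even k then coroot v b f else coroot u a f)"
    define Q where "Q = (if even k then coroot u a f else coroot v b f)"
    have P: "(if even (Suc k) then coroot u a f else coroot v b f) = P"
      and Q: "(if even (Suc k) then coroot v b f else coroot u a f) = Q"
      by (simp_all add: P_def Q_def)
    note IH = IH[folded P_def Q_def]
    have "sin ?t * coroot u a ?h
        = sin ?t * coroot u a ?g + 2 * cos ?t * (sin ?t * coroot v b ?g)"
      by (simp only: hu) (simp only: algebra_simps)
    also have "\<dots> = (2 * cos ?t * sin ((real k + 1) * ?t) - sin (real k * ?t)) * P
        + (2 * cos ?t * sin (real k * ?t) - sin ((real k - 1) * ?t)) * Q"
      by (simp only: IH) (simp add: algebra_simps)
    also have "\<dots> = sin ((real (Suc k) + 1) * ?t) * P + sin (real (Suc k) * ?t) * Q"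
      by (simp only: sw_sum[symmetric] sw_sum'[symmetric]) simp
    finally have 1: "sin ?t * coroot u a ?h
        = sin ((real (Suc k) + 1) * ?t) * P + sin (real (Suc k) * ?t) * Q" .
    have "sin ?t * coroot v b ?h = - (sin ?t * coroot v b ?g)" by (simp only: hv mult_minus_right)
    also have "\<dots> = - sin (real (Suc k) * ?t) * P - sin ((real (Suc k) - 1) * ?t) * Q"
      by (simp only: IH) (simp add: algebra_simps)
    finally have 2: "sin ?t * coroot v b ?h
        = - sin (real (Suc k) * ?t) * P - sin ((real (Suc k) - 1) * ?t) * Q" .
    note 1[folded P Q] 2[folded P Q]
  } note step = this
  {
    case 1
    then show ?case by (rule step(1))
  next
    case 2
    then show ?case by (rule step(2))
  }
qed

text \<open>Each reflection subtracts a multiple of its own root, so all that happens to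
  \<open>f\<close> takes place in the plane of the two roots, and two coefficients decide
  equality.\<close>

lemma act_alternating_span:
  assumes "u \<in> V" "v \<in> V" "order (G u) = 2" "order (G v) = 2"
    "a \<in> carrier (G u) - {\<one>\<^bsub>G u\<^esub>}" "b \<in> carrier (G v) - {\<one>\<^bsub>G v\<^esub>}"
  shows "\<exists>c d. \<forall>p. act (alternating (u, a) (v, b) k) f p = f p - c * root u a p - d * root v b p"
  using assms
proof (induction k arbitrary: u v a b)
  case 0
  then show ?case by (intro exI[of _ 0]) simp
next
  case (Suc k)
  obtain c d where cd: "\<And>p. act (alternating (v, b) (u, a) k) f p = f p - c * root v b p - d * root u a p"
    using Suc.IH[of v u b a] Suc.prems by blast
  show ?case
    using Suc.prems
    by (intro exI[of _ "d + coroot u a (act (alternating (v, b) (u, a) k) f)"] exI[of _ c])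
      (simp add: syllable_act_order_2 cd algebra_simps)
qed

text \<open>Both sides differ from \<open>f\<close> by a combination of the two roots, and such a combination is
  determined by its two coroots because \<open>cos t\<close> is not \<open>\<plusminus>1\<close>.\<close>

lemma act_alternating_order_2:
  assumes "{u, v} \<in> E" "2 < lab {u, v}"
    "a \<in> carrier (G u) - {\<one>\<^bsub>G u\<^esub>}" "b \<in> carrier (G v) - {\<one>\<^bsub>G v\<^esub>}"
  shows "act (alternating (u, a) (v, b) (lab {u, v})) = act (alternating (v, b) (u, a) (lab {u, v}))"
proof
  fix f
  let ?m = "lab {u, v}"
  let ?t = "pi / real ?m"
  let ?g = "act (alternating (u, a) (v, b) ?m) f"
  let ?h = "act (alternating (v, b) (u, a) ?m) f"
  have uv: "u \<in> V" "v \<in> V" "u \<noteq> v" using assms edge_vertices by auto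
  have o: "order (G u) = 2" "order (G v) = 2" using order_2 assms by auto
  have sw: "{v, u} = {u, v}" by auto
  have t: "0 < ?t" "?t < pi" using assms(2) by (auto simp: field_simps)
  then have sin_pos: "0 < sin ?t" by (rule sin_gt_zero)
  have mt: "real ?m * ?t = pi" using assms(2) by simp
  \<comment> \<open>At length equal to the label the word is the longest element of a dihedral
    group: each coroot of the image is minus a coroot of \<open>f\<close>, over the same vertex or
    the other one by the parity of the label, and both words give the same one.\<close>
  have s: "sin ((real ?m + 1) * ?t) = - sin ?t" "sin (real ?m * ?t) = 0" "sin ((real ?m - 1) * ?t) = sin ?t"
    unfolding distrib_right left_diff_distrib mt by simp_all
  have "sin ?t * coroot u a ?g = sin ?t * coroot u a ?h"
    using coroot_alternating(1)[OF assms(1) o assms(3,4), of ?m f]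
      coroot_alternating(2)[of v u b a ?m f, unfolded sw, OF assms(1) o(2,1) assms(4,3)]
    by (simp only: s split: if_splits)
  then have eu: "coroot u a ?g = coroot u a ?h" using sin_pos by simp
  have "sin ?t * coroot v b ?g = sin ?t * coroot v b ?h"
    using coroot_alternating(2)[OF assms(1) o assms(3,4), of ?m f]
      coroot_alternating(1)[of v u b a ?m f, unfolded sw, OF assms(1) o(2,1) assms(4,3)]
    by (simp only: s split: if_splits)
  then have ev: "coroot v b ?g = coroot v b ?h" using sin_pos by simp
  obtain c d where g: "\<And>p. ?g p = f p - c * root u a p - d * root v b p"
    using act_alternating_span[OF uv(1,2) o assms(3,4), of ?m f] by blast
  obtain c' d' where h: "\<And>p. ?h p = f p - d' * root v b p - c' * root u a p"
    using act_alternating_span[OF uv(2,1) o(2,1) assms(4,3), of ?m f] by blast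
  have gh: "?g = (\<lambda>p. (\<lambda>p. ?h p - (c - c') * root u a p) p - (d - d') * root v b p)"
    by (simp add: g h fun_eq_iff algebra_simps)
  have "coroot u a ?g = coroot u a ?h - (c - c') * coroot u a (root u a) - (d - d') * coroot u a (root v b)"
    by (subst gh) (simp only: coroot_diff)
  then have 1: "c - c' = (d - d') * cos ?t"
    using eu assms uv by (simp add: coroot_root coroot_root_other coupling_def sw algebra_simps)
  have "coroot v b ?g = coroot v b ?h - (c - c') * coroot v b (root u a) - (d - d') * coroot v b (root v b)"
    by (subst gh) (simp only: coroot_diff)
  then have 2: "d - d' = (c - c') * cos ?t"
    using ev assms uv by (simp add: coroot_root coroot_root_other coupling_def sw algebra_simps)
  have "(d - d') * (sin ?t)\<^sup>2 = (d - d') - (d - d') * cos ?t * cos ?t"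
    unfolding sin_squared_eq by (simp add: power2_eq_square right_diff_distrib mult.assoc)
  also have "\<dots> = 0" using 1 2 by simp
  finally have "d = d'" using sin_pos by simp
  then have "c = c'" using 1 by simp
  with \<open>d = d'\<close> show "?g = ?h" by (simp add: g h fun_eq_iff)
qed

lemma act_move:
  assumes "move s t"
  shows "act s = act t"
proof -
  have "act s = act t" if "dihedral_move V E lab G s t"
    using that
  proof cases
    case (1 u v a b x y)
    have uv: "u \<in> V" "v \<in> V" "u \<noteq> v" using 1 edge_vertices by auto
    have "act (alternating (u, a) (v, b) (lab {u, v})) = act (alternating (v, b) (u, a) (lab {u, v}))"
    proof (cases "lab {u, v} = 2")
      case True
      then have "coupling u v = 0" using 1 by (simp add: coupling_def)
      then show ?thesis using True uv 1 syllable_act_commute[of u v a b]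
        by (simp add: numeral_2_eq_2 fun_eq_iff)
    next
      case False
      then show ?thesis using 1 label_ge_2[of "{u, v}"] by (intro act_alternating_order_2) auto
    qed
    then show ?thesis unfolding 1 foldr_append by simp
  qed
  moreover have "act s = act t" if "reduction_move V G s t"
    using that by cases (simp add: syllable_act_one fun_eq_iff)
  moreover have "act s = act t" if "fusion_move V G s t"
    using that by cases (simp add: syllable_act_mult fun_eq_iff)
  ultimately show ?thesis using assms unfolding elementary_move_def by blast
qed

section \<open>What the representation shows about vertex-groups and pairs of them\<close>

lemma act_val_eq: "\<lbrakk>w \<in> W; w' \<in> W; val w = val w'\<rbrakk> \<Longrightarrow> act w = act w'"
  by (rule val_eq_invariant) (use act_move in auto)

text \<open>Over \<open>u\<close>, \<open>base\<close> is the indicator of the identity; acting by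
  \<open>a\<close> makes it the indicator of \<open>a\<close>, so \<open>a\<close> can be read
  off.\<close>

lemma val_inj:
  assumes "u \<in> V" "a \<in> carrier (G u)" "a' \<in> carrier (G u)" "val [(u, a)] = val [(u, a')]"
  shows "a = a'"
proof -
  interpret Gu: group "G u" by (rule group_G[OF assms(1)])
  have "act [(u, a)] base (u, a') = act [(u, a')] base (u, a')"
    using act_val_eq[of "[(u, a)]" "[(u, a')]"] assms by simp
  then have "inv\<^bsub>G u\<^esub> a \<otimes>\<^bsub>G u\<^esub> a' = \<one>\<^bsub>G u\<^esub>"
    using assms by (simp add: syllable_act_same base_def split: if_splits)
  then show ?thesis using assms(2,3) by (metis Gu.inv_equality Gu.inv_inv Gu.inv_closed)
qed

text \<open>For order two this is positivity of the coroot, the side of the wall of \<open>u\<close>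
  on which \<open>base\<close> lies. Strictness matters: a dominant function has no dominant
  translate by a nontrivial element of the vertex-group.\<close>

definition dominant :: "'v \<Rightarrow> ('v \<times> 'a \<Rightarrow> real) \<Rightarrow> bool" where
  "dominant u f \<longleftrightarrow> (\<forall>x\<in>carrier (G u) - {\<one>\<^bsub>G u\<^esub>}. f (u, x) < f (u, \<one>\<^bsub>G u\<^esub>))"

text \<open>Ping-pong for non-adjacent vertices: the second conjunct is what makes the induction work.\<close>

lemma dominant_alternating_free:
  assumes "{u, v} \<notin> E" "u \<noteq> v" "u \<in> V" "v \<in> V"
    "a \<in> carrier (G u) - {\<one>\<^bsub>G u\<^esub>}" "b \<in> carrier (G v) - {\<one>\<^bsub>G v\<^esub>}"
    "x \<in> carrier (G u) - {\<one>\<^bsub>G u\<^esub>}"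
  shows "let f = act (alternating (v, b) (u, a) k) base in
    f (u, x) < f (u, \<one>\<^bsub>G u\<^esub>) \<and>
    (\<forall>y\<in>carrier (G v). f (v, y) - f (v, \<one>\<^bsub>G v\<^esub>) \<le> f (u, \<one>\<^bsub>G u\<^esub>) - f (u, x))"
  using assms
proof (induction k arbitrary: u v a b x)
  case 0
  then show ?case by (auto simp: base_def)
next
  case (Suc k)
  interpret Gv: group "G v" by (rule group_G[OF Suc.prems(4)])
  define g where "g = act (alternating (u, a) (v, b) k) base"
  let ?i = "inv\<^bsub>G v\<^esub> b"
  have i: "?i \<in> carrier (G v) - {\<one>\<^bsub>G v\<^esub>}" using Suc.prems by simp
  have IH: "g (v, y) < g (v, \<one>\<^bsub>G v\<^esub>)"
    "g (u, z) - g (u, \<one>\<^bsub>G u\<^esub>) \<le> g (v, \<one>\<^bsub>G v\<^esub>) - g (v, y)"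
    if "y \<in> carrier (G v) - {\<one>\<^bsub>G v\<^esub>}" "z \<in> carrier (G u)" for y z
    using Suc.IH[of v u b a y] Suc.prems that unfolding g_def Let_def by (auto simp: insert_commute)
  have gv: "g (v, y) \<le> g (v, \<one>\<^bsub>G v\<^esub>)" if "y \<in> carrier (G v)" for y
    using IH(1)[of y x] that Suc.prems by (cases "y = \<one>\<^bsub>G v\<^esub>") auto
  have c: "coupling v u = 2" using Suc.prems by (simp add: coupling_def insert_commute)
  have u: "syllable_act (v, b) g (u, \<one>\<^bsub>G u\<^esub>) = g (u, \<one>\<^bsub>G u\<^esub>) + 2 * (g (v, \<one>\<^bsub>G v\<^esub>) - g (v, ?i))"
    "syllable_act (v, b) g (u, x) = g (u, x)"
    using Suc.prems c by (auto simp: syllable_act_other)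
  have v: "syllable_act (v, b) g (v, y) - syllable_act (v, b) g (v, \<one>\<^bsub>G v\<^esub>) \<le> g (v, \<one>\<^bsub>G v\<^esub>) - g (v, ?i)"
    if "y \<in> carrier (G v)" for y
    using that Suc.prems i gv[of "?i \<otimes>\<^bsub>G v\<^esub> y"] by (simp add: syllable_act_same)
  \<comment> \<open>Put \<open>d = g(v,1) - g(v,b^-1)\<close>, which is positive. Coupling 2 adds
    \<open>2 * d\<close> to the gap over \<open>u\<close>, which was at least \<open>-d\<close> by
    the second conjunct for \<open>g\<close>; so the new gap is at least \<open>d\<close>, and
    \<open>d\<close> also bounds the rise over \<open>v\<close>.\<close>
  show ?case
    using IH[OF i, of x] u v Suc.prems by (fastforce simp: g_def[symmetric] Let_def)
qed

text \<open>The analogue of the fact that, below the label, an alternating word starting over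
  \<open>v\<close> has no reduced expression starting over \<open>u\<close>.\<close>

lemma dominant_alternating:
  assumes "u \<noteq> v" "u \<in> V" "v \<in> V"
    "a \<in> carrier (G u) - {\<one>\<^bsub>G u\<^esub>}" "b \<in> carrier (G v) - {\<one>\<^bsub>G v\<^esub>}"
    "{u, v} \<in> E \<Longrightarrow> k < lab {u, v}"
  shows "dominant u (act (alternating (v, b) (u, a) k) base)"
proof (cases "{u, v} \<in> E")
  case False
  then show ?thesis
    using dominant_alternating_free[OF False assms(1-5)] by (auto simp: dominant_def Let_def)
next
  case E: True
  show ?thesis
  proof (cases "lab {u, v} = 2")
    case True
    have "coupling v u = 0" using E True by (simp add: coupling_def insert_commute)
    moreover have "k = 0 \<or> k = 1" using assms(6)[OF E] True by auto
    ultimately show ?thesis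
      using assms by (auto simp: dominant_def base_def syllable_act_other split: if_splits)
  next
    case False
    let ?m = "lab {u, v}"
    let ?t = "pi / real ?m"
    have m: "2 < ?m" using False label_ge_2[OF E] by simp
    then have o: "order (G u) = 2" "order (G v) = 2" using order_2 E by auto
    have t: "0 < ?t" "?t < pi" using m by (auto simp: field_simps)
    then have sin_pos: "0 < sin ?t" by (rule sin_gt_zero)
    have pos: "0 < sin (real j * ?t)" if "0 < j" "j < ?m" for j
      using that by (intro sin_gt_zero) (auto simp: field_simps)
    \<comment> \<open>All coroots of \<open>base\<close> are 1, so this sum is \<open>sin t\<close>
      times the coroot sought. Its first term vanishes at \<open>k = m - 1\<close> and its second at
      \<open>k = 0\<close>; since the label exceeds 2, the other term is then positive.\<close>
    have "0 < sin ((real k + 1) * ?t) + sin (real k * ?t)"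
    proof (cases "k = ?m - 1")
      case True
      then have "(real k + 1) * ?t = pi" using m by (simp add: of_nat_diff)
      then show ?thesis using pos[of k] True m by simp
    next
      case False
      then have "0 < sin (real (Suc k) * ?t)" using assms(6)[OF E] by (intro pos) auto
      moreover have "0 \<le> sin (real k * ?t)"
        using pos[of k] assms(6)[OF E] by (cases "k = 0") auto
      ultimately show ?thesis by (simp add: algebra_simps)
    qed
    moreover have "coroot u a base = 1" "coroot v b base = 1"
      using assms by (auto simp: coroot_def base_def)
    ultimately have "0 < sin ?t * coroot u a (act (alternating (v, b) (u, a) k) base)"
      using coroot_alternating(1)[OF E o assms(4,5), of k base] by simp
    then have "0 < coroot u a (act (alternating (v, b) (u, a) k) base)"
      using sin_pos by (simp add: zero_less_mult_iff)
    then show ?thesis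
      using order_2_nontrivial(1)[of u a] o assms by (auto simp: dominant_def coroot_def)
  qed
qed

text \<open>Applied to \<open>base\<close>, the equation makes two functions dominant over
  \<open>u\<close> translates of each other by \<open>c\<close>. Dominance of each compares the same
  two values, in opposite directions, unless \<open>c\<close> is trivial.\<close>

lemma alternating_shift_trivial:
  assumes "u \<noteq> v" "u \<in> V" "v \<in> V"
    "a \<in> carrier (G u) - {\<one>\<^bsub>G u\<^esub>}" "b \<in> carrier (G v) - {\<one>\<^bsub>G v\<^esub>}" "c \<in> carrier (G u)"
    and k: "{u, v} \<in> E \<Longrightarrow> Suc k < lab {u, v}"
    and eq: "val (alternating (v, b) (u, a) (Suc k)) = val ((u, c) # alternating (v, b) (u, a) k)"
  shows "c = \<one>\<^bsub>G u\<^esub>"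
proof (rule ccontr)
  assume c: "c \<noteq> \<one>\<^bsub>G u\<^esub>"
  interpret Gu: group "G u" by (rule group_G[OF assms(2)])
  let ?f = "act (alternating (v, b) (u, a) k) base"
  let ?g = "act (alternating (v, b) (u, a) (Suc k)) base"
  have "alternating (v, b) (u, a) j \<in> W" "alternating (u, a) (v, b) j \<in> W" for j
    using assms by (auto intro!: alternating_in_words)
  then have "act (alternating (v, b) (u, a) (Suc k)) = act ((u, c) # alternating (v, b) (u, a) k)"
    using assms eq by (intro act_val_eq) auto
  then have g: "?g = syllable_act (u, c) ?f" by (simp add: fun_eq_iff)
  have "dominant u ?g" "dominant u ?f"
    using k by (intro dominant_alternating[OF assms(1-5)]; simp)+
  then have "?g (u, c) < ?g (u, \<one>\<^bsub>G u\<^esub>)" "?f (u, inv\<^bsub>G u\<^esub> c) < ?f (u, \<one>\<^bsub>G u\<^esub>)"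
    using c assms(6) by (simp_all add: dominant_def del: foldr.simps alternating.simps)
  moreover have "?g (u, c) = ?f (u, \<one>\<^bsub>G u\<^esub>)" "?g (u, \<one>\<^bsub>G u\<^esub>) = ?f (u, inv\<^bsub>G u\<^esub> c)"
    using assms(6) by (simp_all only: g syllable_act_same Gu.one_closed Gu.l_inv Gu.r_one Gu.inv_closed)
  ultimately show False by simp
qed

interpretation X: group X
  by (rule group_X)

subsection \<open>Walls and holonomy\<close>

definition conjugate where "conjugate g h = g \<otimes>\<^bsub>X\<^esub> h \<otimes>\<^bsub>X\<^esub> inv\<^bsub>X\<^esub> g"

abbreviation conjugate_wall where "conjugate_wall g \<equiv> map_prod ((`) (conjugate g)) (conjugate g)"

definition vertex_image :: "'v \<Rightarrow> ('v, 'a) word set set set" where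
  "vertex_image u = (\<lambda>a. val [(u, a)]) ` carrier (G u)"

primrec walls :: "('v, 'a) word \<Rightarrow> (('v, 'a) word set set set \<times> ('v, 'a) word set set) list" where
  "walls [] = []"
| "walls (s # w) = (vertex_image (fst s), val [s]) # map (conjugate_wall (val [s])) (walls w)"

text \<open>The product is taken in reverse order: only then do the syllables \<open>a\<close> and \<open>b\<close> of one
  vertex-group, whose walls coincide, contribute \<open>(a b a\<^sup>-\<^sup>1) a = a b\<close>.\<close>

primrec holonomy where
  "holonomy [] H = \<one>\<^bsub>X\<^esub>"
| "holonomy (p # L) H = holonomy L H \<otimes>\<^bsub>X\<^esub> (if fst p = H then snd p else \<one>\<^bsub>X\<^esub>)"

text \<open>The conjugation laws hold only inside the carrier; this is the closure condition that
  lets them be applied throughout a list of walls.\<close>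

definition wall_pairs where "wall_pairs = {(H, h). H \<subseteq> carrier X \<and> h \<in> H}"

lemma conjugate_closed [simp]: "\<lbrakk>g \<in> carrier X; h \<in> carrier X\<rbrakk> \<Longrightarrow> conjugate g h \<in> carrier X"
  by (simp add: conjugate_def)

lemma conjugate_one [simp]: "h \<in> carrier X \<Longrightarrow> conjugate \<one>\<^bsub>X\<^esub> h = h"
  by (simp add: conjugate_def)

lemma conjugate_conjugate: "\<lbrakk>g \<in> carrier X; h \<in> carrier X; x \<in> carrier X\<rbrakk> \<Longrightarrow> conjugate g (conjugate h x) = conjugate (g \<otimes>\<^bsub>X\<^esub> h) x"
  by (simp add: conjugate_def X.m_assoc X.inv_mult_group)

lemma conjugate_mult: "\<lbrakk>g \<in> carrier X; x \<in> carrier X; y \<in> carrier X\<rbrakk>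
    \<Longrightarrow> conjugate g (x \<otimes>\<^bsub>X\<^esub> y) = conjugate g x \<otimes>\<^bsub>X\<^esub> conjugate g y"
  using X.inv_solve_left[of "inv\<^bsub>X\<^esub> g"]
  by (simp add: conjugate_def X.m_assoc) (metis X.inv_closed X.l_inv X.l_one X.m_assoc X.m_closed)

lemma conjugate_of_one [simp]: "g \<in> carrier X \<Longrightarrow> conjugate g \<one>\<^bsub>X\<^esub> = \<one>\<^bsub>X\<^esub>"
  by (simp add: conjugate_def)

lemma inj_on_conjugate: "g \<in> carrier X \<Longrightarrow> inj_on (conjugate g) (carrier X)"
  by (rule inj_on_inverseI[of _ "conjugate (inv\<^bsub>X\<^esub> g)"]) (simp add: conjugate_conjugate)

lemma conjugate_image_conjugate_image: "\<lbrakk>g \<in> carrier X; h \<in> carrier X; H \<subseteq> carrier X\<rbrakk>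
    \<Longrightarrow> conjugate g ` conjugate h ` H = conjugate (g \<otimes>\<^bsub>X\<^esub> h) ` H"
  unfolding image_image by (rule image_cong) (auto simp: conjugate_conjugate subset_iff)

lemma conjugate_image_one: "H \<subseteq> carrier X \<Longrightarrow> conjugate \<one>\<^bsub>X\<^esub> ` H = H"
  using image_cong[of H H "conjugate \<one>\<^bsub>X\<^esub>" id] by (auto simp: subset_iff)

lemma conjugate_image_inv: "\<lbrakk>g \<in> carrier X; H \<subseteq> carrier X\<rbrakk> \<Longrightarrow> conjugate g ` conjugate (inv\<^bsub>X\<^esub> g) ` H = H"
  by (simp add: conjugate_image_conjugate_image conjugate_image_one)

lemma conjugate_image_closed: "\<lbrakk>g \<in> carrier X; H \<subseteq> carrier X\<rbrakk> \<Longrightarrow> conjugate g ` H \<subseteq> carrier X"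
  by (auto simp: subset_iff)

lemma conjugate_image_eq_iff: "\<lbrakk>g \<in> carrier X; H \<subseteq> carrier X; H' \<subseteq> carrier X\<rbrakk>
    \<Longrightarrow> conjugate g ` H = conjugate g ` H' \<longleftrightarrow> H = H'"
  by (rule inj_on_image_eq_iff[OF inj_on_conjugate])

lemma vertex_image_closed: "u \<in> V \<Longrightarrow> vertex_image u \<subseteq> carrier X"
  by (auto simp: vertex_image_def)

text \<open>This is why neighbouring syllables of one vertex-group share a wall. Stability under the
  inverse supplies the reverse inclusion.\<close>

lemma conjugate_vertex_image:
  assumes "u \<in> V" "a \<in> carrier (G u)"
  shows "conjugate (val [(u, a)]) ` vertex_image u = vertex_image u"
proof -
  interpret Gu: group "G u" by (rule group_G[OF assms(1)])
  have c: "conjugate (val [(u, c)]) (val [(u, x)]) = val [(u, c \<otimes>\<^bsub>G u\<^esub> x \<otimes>\<^bsub>G u\<^esub> inv\<^bsub>G u\<^esub> c)]"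
    if "c \<in> carrier (G u)" "x \<in> carrier (G u)" for c x
    using that assms(1) by (simp add: conjugate_def val_mult val_inv)
  have "conjugate (val [(u, c)]) ` vertex_image u \<subseteq> vertex_image u" if "c \<in> carrier (G u)" for c
    using that by (auto simp: c vertex_image_def)
  then have "conjugate (val [(u, a)]) ` vertex_image u \<subseteq> vertex_image u" "conjugate (inv\<^bsub>X\<^esub> (val [(u, a)])) ` vertex_image u \<subseteq> vertex_image u"
    using assms by (simp_all add: val_inv[symmetric])
  moreover have "conjugate (val [(u, a)]) ` conjugate (inv\<^bsub>X\<^esub> (val [(u, a)])) ` vertex_image u = vertex_image u"
    using assms vertex_image_closed[OF assms(1)] by (intro conjugate_image_inv) auto
  ultimately show ?thesis
    using image_mono[of "conjugate (inv\<^bsub>X\<^esub> (val [(u, a)])) ` vertex_image u" "vertex_image u" "conjugate (val [(u, a)])"]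
    by (intro subset_antisym) simp_all
qed

lemma wall_pairs_conjugate_wall: "\<lbrakk>g \<in> carrier X; p \<in> wall_pairs\<rbrakk> \<Longrightarrow> conjugate_wall g p \<in> wall_pairs"
  by (auto simp: wall_pairs_def subset_iff)

lemma wall_pairs_map_conjugate_wall: "\<lbrakk>g \<in> carrier X; set L \<subseteq> wall_pairs\<rbrakk> \<Longrightarrow> set (map (conjugate_wall g) L) \<subseteq> wall_pairs"
  unfolding set_map by (rule image_subsetI, rule wall_pairs_conjugate_wall, assumption, erule subsetD)

lemma walls_wall_pairs: "w \<in> W \<Longrightarrow> set (walls w) \<subseteq> wall_pairs"
proof (induction w)
  case (Cons s w)
  obtain u a where s: "s = (u, a)" by force
  have "(vertex_image u, val [(u, a)]) \<in> wall_pairs"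
    using Cons.prems vertex_image_closed[of u] by (auto simp: s wall_pairs_def vertex_image_def)
  moreover have "conjugate_wall (val [s]) p \<in> wall_pairs" if "p \<in> set (walls w)" for p
    using that Cons by (intro wall_pairs_conjugate_wall) (auto simp: s)
  ultimately show ?case by (auto simp: s)
qed simp

lemma conjugate_wall_conjugate_wall: "\<lbrakk>g \<in> carrier X; h \<in> carrier X; p \<in> wall_pairs\<rbrakk> \<Longrightarrow> conjugate_wall g (conjugate_wall h p) = conjugate_wall (g \<otimes>\<^bsub>X\<^esub> h) p"
  by (cases p) (auto simp: wall_pairs_def conjugate_conjugate conjugate_image_conjugate_image)

lemma conjugate_wall_one: "p \<in> wall_pairs \<Longrightarrow> conjugate_wall \<one>\<^bsub>X\<^esub> p = p"
  by (cases p) (auto simp: wall_pairs_def conjugate_image_one)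

lemma walls_append:
  "\<lbrakk>x \<in> W; y \<in> W\<rbrakk> \<Longrightarrow> walls (x @ y) = walls x @ map (conjugate_wall (val x)) (walls y)"
proof (induction x)
  case Nil
  have "map (conjugate_wall \<one>\<^bsub>X\<^esub>) (walls y) = walls y"
    using walls_wall_pairs[OF Nil(2)] by (intro map_idI conjugate_wall_one) auto
  then show ?case by simp
next
  case (Cons s x)
  obtain u a where s: "s = (u, a)" by force
  have "map (conjugate_wall (val [s])) (map (conjugate_wall (val x)) (walls y)) = map (conjugate_wall (val (s # x))) (walls y)"
    using walls_wall_pairs[OF Cons.prems(2)] Cons.prems
    unfolding map_map o_def by (intro map_cong refl) (auto simp: s val_Cons[of _ x] conjugate_wall_conjugate_wall simp del: map_prod_simp)
  then show ?case using Cons by (simp add: s)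
qed

lemma length_walls [simp]: "length (walls w) = length w"
  by (induction w) auto

lemma holonomy_closed [simp]: "set L \<subseteq> wall_pairs \<Longrightarrow> holonomy L H \<in> carrier X"
  by (induction L) (auto simp: wall_pairs_def)

lemma holonomy_append:
  "\<lbrakk>set L \<subseteq> wall_pairs; set L' \<subseteq> wall_pairs\<rbrakk> \<Longrightarrow> holonomy (L @ L') H = holonomy L' H \<otimes>\<^bsub>X\<^esub> holonomy L H"
  by (induction L) (auto simp: X.m_assoc wall_pairs_def)

lemma holonomy_map_conjugate_wall:
  assumes "g \<in> carrier X" "H \<subseteq> carrier X" "set L \<subseteq> wall_pairs"
  shows "holonomy (map (conjugate_wall g) L) (conjugate g ` H) = conjugate g (holonomy L H)"
  using assms(3)
proof (induction L)
  case Nil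
  then show ?case using assms by simp
next
  case (Cons p L)
  then have p: "fst p \<subseteq> carrier X" "snd p \<in> carrier X" by (auto simp: wall_pairs_def)
  have "fst p = H \<longleftrightarrow> conjugate g ` fst p = conjugate g ` H" using conjugate_image_eq_iff[of g "fst p" H] assms p by simp
  then show ?case using Cons p assms by (simp add: conjugate_mult)
qed

text \<open>Invariance may be checked on the subword that changes: the suffix sees only
  \<open>val s = val t\<close>, and the prefix conjugates everything. The hypothesis ranges over all
  \<open>H\<close> because undoing that conjugation replaces \<open>H\<close> by a
  conjugate.\<close>

lemma holonomy_walls_context:
  assumes "s \<in> W" "t \<in> W" "val s = val t"
    and eq: "\<And>H. H \<subseteq> carrier X \<Longrightarrow> holonomy (walls s) H = holonomy (walls t) H"
    and "x \<in> W" "y \<in> W" "H \<subseteq> carrier X"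
  shows "holonomy (walls (x @ s @ y)) H = holonomy (walls (x @ t @ y)) H"
proof -
  let ?g = "val x"
  let ?H = "conjugate (inv\<^bsub>X\<^esub> ?g) ` H"
  have H: "conjugate ?g ` ?H = H" "?H \<subseteq> carrier X"
    using assms by (simp_all only: conjugate_image_inv conjugate_image_closed X.inv_closed val_closed)
  have "holonomy (walls (x @ r @ y)) H
      = conjugate ?g (holonomy (map (conjugate_wall (val r)) (walls y)) ?H \<otimes>\<^bsub>X\<^esub> holonomy (walls r) ?H) \<otimes>\<^bsub>X\<^esub> holonomy (walls x) H"
    if r: "r \<in> W" for r
  proof -
    have y: "set (map (conjugate_wall (val r)) (walls y)) \<subseteq> wall_pairs"
      using walls_wall_pairs[OF assms(6)] r by (intro wall_pairs_map_conjugate_wall val_closed)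
    have ry: "set (walls (r @ y)) \<subseteq> wall_pairs" using walls_wall_pairs r assms by simp
    then have xry: "set (map (conjugate_wall ?g) (walls (r @ y))) \<subseteq> wall_pairs"
      using assms(5) by (intro wall_pairs_map_conjugate_wall val_closed)
    have "holonomy (walls (x @ r @ y)) H = holonomy (map (conjugate_wall ?g) (walls (r @ y))) (conjugate ?g ` ?H) \<otimes>\<^bsub>X\<^esub> holonomy (walls x) H"
      using assms r holonomy_append[OF walls_wall_pairs[OF assms(5)] xry] by (simp add: walls_append H)
    also have "\<dots> = conjugate ?g (holonomy (walls (r @ y)) ?H) \<otimes>\<^bsub>X\<^esub> holonomy (walls x) H"
      using holonomy_map_conjugate_wall[OF val_closed[OF assms(5)] H(2) ry] by simp
    also have "holonomy (walls (r @ y)) ?H = holonomy (map (conjugate_wall (val r)) (walls y)) ?H \<otimes>\<^bsub>X\<^esub> holonomy (walls r) ?H"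
      using holonomy_append[OF walls_wall_pairs[OF r] y] by (simp only: walls_append[OF r assms(6)])
    finally show ?thesis .
  qed
  then show ?thesis using assms(1-3) eq[OF H(2)] by simp
qed

section \<open>Holonomy across the moves\<close>

lemma holonomy_commute:
  assumes "set L \<subseteq> wall_pairs" "x \<in> carrier X"
    "\<And>h. (H, h) \<in> set L \<Longrightarrow> x \<otimes>\<^bsub>X\<^esub> h = h \<otimes>\<^bsub>X\<^esub> x"
  shows "x \<otimes>\<^bsub>X\<^esub> holonomy L H = holonomy L H \<otimes>\<^bsub>X\<^esub> x"
  using assms(1,3)
proof (induction L)
  case Nil
  then show ?case using assms(2) by simp
next
  case (Cons p L)
  obtain K h where p: "p = (K, h)" by force
  have h: "h \<in> carrier X" using Cons.prems by (auto simp: p wall_pairs_def)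
  have IH: "x \<otimes>\<^bsub>X\<^esub> holonomy L H = holonomy L H \<otimes>\<^bsub>X\<^esub> x" using Cons by auto
  have L: "holonomy L H \<in> carrier X" using Cons.prems by simp
  show ?case
  proof (cases "K = H")
    case True
    then have "x \<otimes>\<^bsub>X\<^esub> h = h \<otimes>\<^bsub>X\<^esub> x" using Cons.prems by (simp add: p)
    then have "x \<otimes>\<^bsub>X\<^esub> (holonomy L H \<otimes>\<^bsub>X\<^esub> h) = holonomy L H \<otimes>\<^bsub>X\<^esub> h \<otimes>\<^bsub>X\<^esub> x"
      using h L IH assms(2) by (metis X.m_assoc)
    then show ?thesis using True by (simp add: p)
  next
    case False
    then show ?thesis using IH L by (simp add: p)
  qed
qed

lemma holonomy_rev:
  assumes "set L \<subseteq> wall_pairs"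
    "\<And>h h'. \<lbrakk>(H, h) \<in> set L; (H, h') \<in> set L\<rbrakk> \<Longrightarrow> h \<otimes>\<^bsub>X\<^esub> h' = h' \<otimes>\<^bsub>X\<^esub> h"
  shows "holonomy (rev L) H = holonomy L H"
  using assms
proof (induction L)
  case (Cons p L)
  have p: "snd p \<in> carrier X" using Cons.prems by (auto simp: wall_pairs_def)
  have IH: "holonomy (rev L) H = holonomy L H" using Cons by auto
  have "snd p \<otimes>\<^bsub>X\<^esub> holonomy L H = holonomy L H \<otimes>\<^bsub>X\<^esub> snd p" if "fst p = H"
    using Cons.prems that p by (intro holonomy_commute) (cases p, auto)+
  then show ?case
    using Cons.prems p holonomy_append[of "rev L" "[p]" H] by (auto simp: IH)
qed simp

text \<open>Past length \<open>m\<close>, each letter appended on the left-hand side cancels the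
  last letter of the other alternating word.\<close>

lemma val_alternating_reflect:
  assumes st: "[s] \<in> W" "[t] \<in> W"
    "val [s] \<otimes>\<^bsub>X\<^esub> val [s] = \<one>\<^bsub>X\<^esub>" "val [t] \<otimes>\<^bsub>X\<^esub> val [t] = \<one>\<^bsub>X\<^esub>"
    and m: "val (alternating s t m) = val (alternating t s m)" and j: "j \<le> m"
  shows "val (alternating s t (m + j)) = val (alternating t s (m - j))"
  using j
proof (induction j)
  case 0
  then show ?case using m by simp
next
  case (Suc j)
  have W: "alternating s t k \<in> W" "alternating t s k \<in> W" for k
    using st alternating_in_words[of "fst s" V "fst t" "snd s" G "snd t" k]
      alternating_in_words[of "fst t" V "fst s" "snd t" G "snd s" k] by (cases s; cases t; simp)+
  define c where "c = (if even (m + j) then s else t)"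
  have c: "[c] \<in> W" "val [c] \<otimes>\<^bsub>X\<^esub> val [c] = \<one>\<^bsub>X\<^esub>" using st by (auto simp: c_def)
  have mj: "m - j = Suc (m - Suc j)" using Suc.prems by simp
  have "(if even (m - Suc j) then t else s) = c"
    using Suc.prems by (auto simp: c_def)
  then have "val (alternating t s (m - j)) = val (alternating t s (m - Suc j)) \<otimes>\<^bsub>X\<^esub> val [c]"
    using W c by (simp add: mj alternating_Suc_snoc val_append del: alternating.simps)
  moreover have "val (alternating s t (m + Suc j)) = val (alternating s t (m + j)) \<otimes>\<^bsub>X\<^esub> val [c]"
    using W c by (simp add: alternating_Suc_snoc val_append c_def del: alternating.simps)
  ultimately show ?case using Suc W c by (simp add: X.m_assoc)
qed

lemma vertex_image_order_2:
  assumes "u \<in> V" "order (G u) = 2" "a \<in> carrier (G u) - {\<one>\<^bsub>G u\<^esub>}"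
  shows "vertex_image u = {\<one>\<^bsub>X\<^esub>, val [(u, a)]}" "val [(u, a)] \<otimes>\<^bsub>X\<^esub> val [(u, a)] = \<one>\<^bsub>X\<^esub>"
    "inv\<^bsub>X\<^esub> (val [(u, a)]) = val [(u, a)]"
proof -
  have a: "carrier (G u) = {\<one>\<^bsub>G u\<^esub>, a}" "inv\<^bsub>G u\<^esub> a = a"
    using order_2_nontrivial assms by auto
  show "vertex_image u = {\<one>\<^bsub>X\<^esub>, val [(u, a)]}" using assms by (simp add: vertex_image_def a)
  show inv: "inv\<^bsub>X\<^esub> (val [(u, a)]) = val [(u, a)]"
    using val_inv[of u a] assms a by simp
  have "val [(u, a)] \<otimes>\<^bsub>X\<^esub> inv\<^bsub>X\<^esub> (val [(u, a)]) = \<one>\<^bsub>X\<^esub>"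
    using assms by (intro X.r_inv) simp
  then show "val [(u, a)] \<otimes>\<^bsub>X\<^esub> val [(u, a)] = \<one>\<^bsub>X\<^esub>" by (simp only: inv)
qed

text \<open>The conjugate of an involution by an alternating prefix of length \<open>i\<close> is
  the palindrome of length \<open>2 * i + 1\<close>, possibly longer than the label.\<close>

lemma walls_alternating_order_2:
  assumes "u \<in> V" "v \<in> V" "order (G u) = 2" "order (G v) = 2"
    "a \<in> carrier (G u) - {\<one>\<^bsub>G u\<^esub>}" "b \<in> carrier (G v) - {\<one>\<^bsub>G v\<^esub>}"
  shows "walls (alternating (u, a) (v, b) k)
    = map (\<lambda>i. ({\<one>\<^bsub>X\<^esub>, val (alternating (u, a) (v, b) (Suc (2 * i)))},
        val (alternating (u, a) (v, b) (Suc (2 * i))))) [0..<k]"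
  using assms
proof (induction k arbitrary: u v a b)
  case (Suc k)
  have W: "alternating (u, a) (v, b) j \<in> W" "alternating (v, b) (u, a) j \<in> W" for j
    using Suc.prems by (auto intro!: alternating_in_words)
  have s: "[(u, a)] \<in> W" using Suc.prems by simp
  have conj: "conjugate (val [(u, a)]) (val (alternating (v, b) (u, a) (Suc (2 * i))))
      = val (alternating (u, a) (v, b) (Suc (2 * Suc i)))" for i
  proof -
    have "alternating (u, a) (v, b) (Suc (2 * Suc i))
        = [(u, a)] @ alternating (v, b) (u, a) (Suc (2 * i)) @ [(u, a)]"
      using alternating_Suc_snoc[of "(v, b)" "(u, a)" "Suc (2 * i)"] by simp
    then show ?thesis
      using W s vertex_image_order_2[OF Suc.prems(1,3,5)]
      by (simp only: val_append words_append_iff) (simp add: conjugate_def X.m_assoc del: alternating.simps)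
  qed
  have IH: "walls (alternating (v, b) (u, a) k)
    = map (\<lambda>i. ({\<one>\<^bsub>X\<^esub>, val (alternating (v, b) (u, a) (Suc (2 * i)))},
        val (alternating (v, b) (u, a) (Suc (2 * i))))) [0..<k]"
    using Suc by blast
  show ?case
    unfolding alternating.simps(2)[of "(u, a)" "(v, b)" k] walls.simps(2) IH map_map o_def map_upt_Suc
      map_prod_simp image_insert image_empty conj
    using s by (simp add: vertex_image_order_2(1)[OF Suc.prems(1,3,5)])
qed simp

lemma walls_alternating_rev:
  assumes "{u, v} \<in> E" "2 < lab {u, v}"
    "a \<in> carrier (G u) - {\<one>\<^bsub>G u\<^esub>}" "b \<in> carrier (G v) - {\<one>\<^bsub>G v\<^esub>}"
  shows "walls (alternating (v, b) (u, a) (lab {u, v})) = rev (walls (alternating (u, a) (v, b) (lab {u, v})))"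
proof -
  let ?m = "lab {u, v}"
  have uv: "u \<in> V" "v \<in> V" using assms edge_vertices by auto
  have o: "order (G u) = 2" "order (G v) = 2" using order_2 assms by auto
  have sq: "val [(u, a)] \<otimes>\<^bsub>X\<^esub> val [(u, a)] = \<one>\<^bsub>X\<^esub>" "val [(v, b)] \<otimes>\<^bsub>X\<^esub> val [(v, b)] = \<one>\<^bsub>X\<^esub>"
    using vertex_image_order_2 uv o assms by auto
  have st: "[(u, a)] \<in> W" "[(v, b)] \<in> W" using uv assms by auto
  note m = val_alternating[OF assms(1,3,4)]
  \<comment> \<open>The two palindrome lengths add up to twice the label, so they lie symmetrically
    about it; which of them is the longer decides the direction of the reflection.\<close>
  have "val (alternating (v, b) (u, a) (Suc (2 * i)))
      = val (alternating (u, a) (v, b) (Suc (2 * (?m - Suc i))))" if "i < ?m" for i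
  proof (cases "?m \<le> Suc (2 * i)")
    case True
    then have "?m + (Suc (2 * i) - ?m) = Suc (2 * i)"
      "?m - (Suc (2 * i) - ?m) = Suc (2 * (?m - Suc i))" "Suc (2 * i) - ?m \<le> ?m" using that by auto
    then show ?thesis
      using val_alternating_reflect[OF st(2,1) sq(2,1) m[symmetric], of "Suc (2 * i) - ?m"] by metis
  next
    case False
    then have "?m - (?m - Suc (2 * i)) = Suc (2 * i)"
      "?m + (?m - Suc (2 * i)) = Suc (2 * (?m - Suc i))" "?m - Suc (2 * i) \<le> ?m" by auto
    then show ?thesis
      using val_alternating_reflect[OF st sq m, of "?m - Suc (2 * i)"] by metis
  qed
  then show ?thesis
    unfolding walls_alternating_order_2[OF uv o assms(3,4)] walls_alternating_order_2[OF uv(2,1) o(2,1) assms(4,3)]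
    by (intro nth_equalityI) (simp_all add: rev_nth del: alternating.simps)
qed

lemma holonomy_walls_alternating:
  assumes "{u, v} \<in> E"
    "a \<in> carrier (G u) - {\<one>\<^bsub>G u\<^esub>}" "b \<in> carrier (G v) - {\<one>\<^bsub>G v\<^esub>}"
  shows "holonomy (walls (alternating (u, a) (v, b) (lab {u, v}))) H
    = holonomy (walls (alternating (v, b) (u, a) (lab {u, v}))) H"
proof (cases "lab {u, v} = 2")
  case True
  have uv: "u \<in> V" "v \<in> V" using assms edge_vertices by auto
  \<comment> \<open>Dihedral relations speak of nontrivial elements only, but fixing the whole
    vertex-group under conjugation requires the trivial one too.\<close>
  have comm: "val [(u, x)] \<otimes>\<^bsub>X\<^esub> val [(v, y)] = val [(v, y)] \<otimes>\<^bsub>X\<^esub> val [(u, x)]"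
    if "x \<in> carrier (G u)" "y \<in> carrier (G v)" for x y
  proof (cases "x = \<one>\<^bsub>G u\<^esub> \<or> y = \<one>\<^bsub>G v\<^esub>")
    case False
    then show ?thesis
      using val_alternating[OF assms(1), of x y] that uv True
        val_append[of "[(u, x)]" "[(v, y)]"] val_append[of "[(v, y)]" "[(u, x)]"]
      by (simp add: numeral_2_eq_2)
  qed (use that uv in auto)
  have trivial: "conjugate g h = h" if "g \<in> carrier X" "h \<in> carrier X" "g \<otimes>\<^bsub>X\<^esub> h = h \<otimes>\<^bsub>X\<^esub> g" for g h
    using that by (simp add: conjugate_def X.m_assoc)
  have a: "a \<in> carrier (G u)" and b: "b \<in> carrier (G v)" using assms by auto
  have conjugate_ab: "conjugate (val [(u, a)]) (val [(v, y)]) = val [(v, y)]" if "y \<in> carrier (G v)" for y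
    using that uv a comm by (intro trivial) auto
  have conjugate_ba: "conjugate (val [(v, b)]) (val [(u, x)]) = val [(u, x)]" if "x \<in> carrier (G u)" for x
    using that uv b comm by (intro trivial) auto
  have "conjugate (val [(u, a)]) ` vertex_image v = vertex_image v" "conjugate (val [(v, b)]) ` vertex_image u = vertex_image u"
    by (auto simp: vertex_image_def image_image conjugate_ab conjugate_ba)
  \<comment> \<open>The two walls merely change places. They have not been shown to differ, so
    commutation of the two values covers the case of both being \<open>H\<close>.\<close>
  then show ?thesis
    using uv a b comm[OF a b] by (simp add: True numeral_2_eq_2 conjugate_ab conjugate_ba)
next
  case False
  then have m: "2 < lab {u, v}" using label_ge_2[OF assms(1)] by simp
  have uv: "u \<in> V" "v \<in> V" using assms edge_vertices by auto
  have o: "order (G u) = 2" "order (G v) = 2" using order_2 assms m by auto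
  let ?L = "walls (alternating (u, a) (v, b) (lab {u, v}))"
  have "set ?L \<subseteq> wall_pairs"
    using uv assms by (intro walls_wall_pairs alternating_in_words) auto
  \<comment> \<open>A wall of the form \<open>{1, h}\<close> determines \<open>h\<close>, so all
    elements attached to one wall coincide and in particular commute.\<close>
  moreover have "K = {\<one>\<^bsub>X\<^esub>, h}" if "(K, h) \<in> set ?L" for K h
    using that unfolding walls_alternating_order_2[OF uv o assms(2,3)] by auto
  then have "h = h'" if "(H, h) \<in> set ?L" "(H, h') \<in> set ?L" for h h'
    using that by (metis doubleton_eq_iff)
  ultimately have "holonomy (rev ?L) H = holonomy ?L H" by (intro holonomy_rev) auto
  then show ?thesis by (simp add: walls_alternating_rev[OF assms(1) m assms(2,3)])
qed

lemma holonomy_walls_move: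
  assumes "move s t" "H \<subseteq> carrier X"
  shows "holonomy (walls s) H = holonomy (walls t) H"
proof -
  have "holonomy (walls s) H = holonomy (walls t) H" if "dihedral_move V E lab G s t"
    using that
  proof cases
    case (1 u v a b x y)
    then have "alternating (u, a) (v, b) (lab {u, v}) \<in> W" "alternating (v, b) (u, a) (lab {u, v}) \<in> W"
      using move_words[OF assms(1)] by auto
    then show ?thesis
      unfolding 1 using 1 assms by (intro holonomy_walls_context holonomy_walls_alternating val_alternating) auto
  qed
  moreover have "holonomy (walls s) H = holonomy (walls t) H" if "reduction_move V G s t"
    using that
  proof cases
    case (1 u x y)
    then have "holonomy (walls (x @ [(u, \<one>\<^bsub>G u\<^esub>)] @ y)) H = holonomy (walls (x @ [] @ y)) H"
      using assms by (intro holonomy_walls_context) auto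
    then show ?thesis by (simp add: 1)
  qed
  moreover have "holonomy (walls s) H = holonomy (walls t) H" if "fusion_move V G s t"
    using that
  proof cases
    case (1 u a b x y)
    then have ab: "val [(u, a), (u, b)] = val [(u, a)] \<otimes>\<^bsub>X\<^esub> val [(u, b)]"
      using val_append[of "[(u, a)]" "[(u, b)]"] by simp
    have "holonomy (walls [(u, a), (u, b)]) K = holonomy (walls [(u, a \<otimes>\<^bsub>G u\<^esub> b)]) K" for K
      using 1 conjugate_vertex_image[of u a] by (simp add: val_mult) (simp add: conjugate_def X.m_assoc)
    then show ?thesis
      unfolding 1 using 1 assms ab by (intro holonomy_walls_context) (simp_all add: val_mult)
  qed
  ultimately show ?thesis using assms unfolding elementary_move_def by blast
qed

lemma holonomy_walls_val_eq:
  "\<lbrakk>w \<in> W; w' \<in> W; val w = val w'; H \<subseteq> carrier X\<rbrakk> \<Longrightarrow> holonomy (walls w) H = holonomy (walls w') H"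
  by (rule val_eq_invariant[where \<phi> = "\<lambda>w. holonomy (walls w) H"]) (use holonomy_walls_move in auto)

subsection \<open>Taut words\<close>

abbreviation dihedral where "dihedral \<equiv> dihedral_move V E lab G"

definition taut :: "('v, 'a) word \<Rightarrow> bool" where
  "taut w \<longleftrightarrow> w \<in> W \<and> distinct (map fst (walls w)) \<and> \<one>\<^bsub>X\<^esub> \<notin> snd ` set (walls w)"

text \<open>The analogue of the set of walls separating the identity from the element represented.
  The restriction to subsets of the carrier matches the range in which holonomy is
  invariant.\<close>

definition wall_support where
  "wall_support w = {H. H \<subseteq> carrier X \<and> holonomy (walls w) H \<noteq> \<one>\<^bsub>X\<^esub>}"

lemma fst_imageI: "(H, h) \<in> S \<Longrightarrow> H \<in> fst ` S"
  by (rule image_eqI[of _ _ "(H, h)"]) simp_all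

lemma snd_imageI: "(H, h) \<in> S \<Longrightarrow> h \<in> snd ` S"
  by (rule image_eqI[of _ _ "(H, h)"]) simp_all

lemma conjugate_eq_one_iff:
  "\<lbrakk>g \<in> carrier X; h \<in> carrier X\<rbrakk> \<Longrightarrow> conjugate g h = \<one>\<^bsub>X\<^esub> \<longleftrightarrow> h = \<one>\<^bsub>X\<^esub>"
  using inj_on_eq_iff[OF inj_on_conjugate, of g h "\<one>\<^bsub>X\<^esub>"] by simp

lemma holonomy_not_wall: "H \<notin> fst ` set L \<Longrightarrow> holonomy L H = \<one>\<^bsub>X\<^esub>"
  by (induction L) auto

lemma holonomy_distinct:
  assumes "set L \<subseteq> wall_pairs" "distinct (map fst L)" "(H, h) \<in> set L"
  shows "holonomy L H = h"
  using assms
proof (induction L)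
  case (Cons p L)
  have p: "snd p \<in> carrier X" using Cons.prems by (auto simp: wall_pairs_def)
  show ?case
  proof (cases "p = (H, h)")
    case True
    then have "holonomy L H = \<one>\<^bsub>X\<^esub>" using Cons.prems by (intro holonomy_not_wall) auto
    then show ?thesis using True p by simp
  next
    case False
    then have "(H, h) \<in> set L" using Cons.prems by simp
    moreover from this have "fst p \<noteq> H" using Cons.prems fst_imageI by fastforce
    ultimately show ?thesis using Cons by auto
  qed
qed simp

lemma taut_holonomy: "\<lbrakk>taut w; (H, h) \<in> set (walls w)\<rbrakk> \<Longrightarrow> holonomy (walls w) H = h"
  using walls_wall_pairs[of w] holonomy_distinct[of "walls w" H h] by (simp add: taut_def)

lemma wall_support_subset: "wall_support w \<subseteq> fst ` set (walls w)"
proof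
  fix H assume "H \<in> wall_support w"
  then show "H \<in> fst ` set (walls w)"
    using holonomy_not_wall[of H "walls w"] unfolding wall_support_def by blast
qed

section \<open>Taut words and minimal length\<close>

lemma wall_support_val_eq:
  "\<lbrakk>w \<in> W; w' \<in> W; val w = val w'\<rbrakk> \<Longrightarrow> wall_support w = wall_support w'"
  using holonomy_walls_val_eq[of w w'] by (auto simp: wall_support_def)

lemma taut_wall_support:
  assumes "taut w"
  shows "wall_support w = fst ` set (walls w)"
proof -
  have "H \<in> wall_support w" if "(H, h) \<in> set (walls w)" for H h
  proof -
    have "H \<subseteq> carrier X" using walls_wall_pairs[of w] assms that by (auto simp: taut_def wall_pairs_def)
    moreover have "h \<noteq> \<one>\<^bsub>X\<^esub>" using assms snd_imageI[OF that] by (auto simp only: taut_def)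
    ultimately show ?thesis using taut_holonomy[OF assms that] by (simp add: wall_support_def)
  qed
  then show ?thesis using wall_support_subset[of w] by auto
qed

lemma card_wall_support_le: "card (wall_support w) \<le> length w"
proof -
  have "card (wall_support w) \<le> card (set (map fst (walls w)))"
    using wall_support_subset by (intro card_mono) auto
  also have "\<dots> \<le> length w" using card_length[of "map fst (walls w)"] by simp
  finally show ?thesis .
qed

lemma taut_card_wall_support:
  assumes "taut w"
  shows "card (wall_support w) = length w"
proof -
  have "card (set (map fst (walls w))) = length w"
    using assms distinct_card[of "map fst (walls w)"] by (simp add: taut_def)
  then show ?thesis using taut_wall_support[OF assms] by simp
qed

lemma taut_length_le:
  assumes "taut w" "w' \<in> W" "val w = val w'"
  shows "length w \<le> length w'"
proof -
  have "wall_support w = wall_support w'"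
    using assms by (intro wall_support_val_eq) (auto simp: taut_def)
  then show ?thesis using taut_card_wall_support[OF assms(1)] card_wall_support_le[of w'] by simp
qed

text \<open>The equality case of the counting bound: as many support walls as syllables leaves room
  neither for a repeated wall nor for one with trivial element.\<close>

lemma taut_if_length_le:
  assumes "taut w" "w' \<in> W" "val w = val w'" "length w' \<le> length w"
  shows "taut w'"
proof -
  let ?L = "map fst (walls w')"
  have sup: "wall_support w = wall_support w'"
    using assms by (intro wall_support_val_eq) (auto simp: taut_def)
  have sub: "wall_support w' \<subseteq> set ?L" using wall_support_subset[of w'] by simp
  have n: "length ?L \<le> card (wall_support w')"
    using assms(4) taut_card_wall_support[OF assms(1)] sup by simp
  have "card (wall_support w') \<le> card (set ?L)" using sub by (intro card_mono) auto
  moreover have "card (set ?L) \<le> length ?L" by (rule card_length)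
  ultimately have card: "card (set ?L) = length ?L" "card (wall_support w') = card (set ?L)" using n by linarith+
  have d: "distinct ?L" using card(1) by (rule card_distinct)
  have s: "wall_support w' = set ?L" using card(2) sub by (intro card_subset_eq) auto
  have "(H, \<one>\<^bsub>X\<^esub>) \<notin> set (walls w')" for H
  proof
    assume h: "(H, \<one>\<^bsub>X\<^esub>) \<in> set (walls w')"
    have "H \<in> wall_support w'" using fst_imageI[OF h] s by simp
    then show False
      using holonomy_distinct[OF walls_wall_pairs[OF assms(2)] d h] by (simp add: wall_support_def)
  qed
  then have "\<one>\<^bsub>X\<^esub> \<notin> snd ` set (walls w')" by auto
  then show ?thesis using d assms(2) by (simp add: taut_def)
qed

text \<open>In a taut word the element attached to a wall is its holonomy, hence an invariant of the
  group element.\<close>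

lemma taut_walls_subset:
  assumes "taut w" "taut w'" "val w = val w'"
  shows "set (walls w) \<subseteq> set (walls w')"
proof (rule subrelI)
  fix H h assume Hh: "(H, h) \<in> set (walls w)"
  have W: "w \<in> W" "w' \<in> W" using assms by (auto simp: taut_def)
  have "H \<in> wall_support w" using fst_imageI[OF Hh] taut_wall_support[OF assms(1)] by simp
  moreover have H: "H \<subseteq> carrier X" using calculation by (simp add: wall_support_def)
  ultimately have "H \<in> fst ` set (walls w')"
    using wall_support_val_eq[OF W assms(3)] taut_wall_support[OF assms(2)] by simp
  then obtain h' where h': "(H, h') \<in> set (walls w')" by auto
  have "h' = h"
    using taut_holonomy[OF assms(1) Hh] taut_holonomy[OF assms(2) h'] holonomy_walls_val_eq[OF W assms(3) H] by simp
  then show "(H, h) \<in> set (walls w')" using h' by simp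
qed

lemma taut_Cons_tail:
  assumes "taut (s # x)"
  shows "taut x"
proof -
  have W: "[s] \<in> W" "x \<in> W" using assms by (cases s; simp add: taut_def)+
  have "map fst (map (conjugate_wall (val [s])) (walls x)) = map ((`) (conjugate (val [s]))) (map fst (walls x))"
    by simp
  then have "distinct (map ((`) (conjugate (val [s]))) (map fst (walls x)))"
    using assms by (simp only: taut_def walls.simps list.map distinct.simps)
  then have "distinct (map fst (walls x))" unfolding distinct_map by blast
  moreover have "\<one>\<^bsub>X\<^esub> \<notin> snd ` set (walls x)"
  proof
    assume "\<one>\<^bsub>X\<^esub> \<in> snd ` set (walls x)"
    then obtain H where "(H, \<one>\<^bsub>X\<^esub>) \<in> set (walls x)" by auto
    then have "conjugate_wall (val [s]) (H, \<one>\<^bsub>X\<^esub>) \<in> set (walls (s # x))"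
      unfolding walls.simps list.set set_map by (intro insertI2 imageI)
    then have "(conjugate (val [s]) ` H, \<one>\<^bsub>X\<^esub>) \<in> set (walls (s # x))" using W by simp
    from snd_imageI[OF this] show False using assms unfolding taut_def by blast
  qed
  ultimately show ?thesis using W by (simp add: taut_def)
qed

section \<open>Exchange and alternating prefixes\<close>

lemma val_eq_one_iff:
  "\<lbrakk>u \<in> V; a \<in> carrier (G u)\<rbrakk> \<Longrightarrow> val [(u, a)] = \<one>\<^bsub>X\<^esub> \<longleftrightarrow> a = \<one>\<^bsub>G u\<^esub>"
  using val_inj[of u a "\<one>\<^bsub>G u\<^esub>"] by auto

lemma taut_Cons_nontrivial: "taut ((u, a) # x) \<Longrightarrow> u \<in> V \<and> a \<in> carrier (G u) - {\<one>\<^bsub>G u\<^esub>}"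
  by (auto simp: taut_def)

text \<open>Conjugation by the new syllable is injective and fixes \<open>vertex_image u\<close>, so
  the new wall collides with a shifted old one only if it already was a wall of
  \<open>x\<close>.\<close>

lemma taut_ConsI:
  assumes "taut x" "u \<in> V" "a \<in> carrier (G u) - {\<one>\<^bsub>G u\<^esub>}" "vertex_image u \<notin> fst ` set (walls x)"
  shows "taut ((u, a) # x)"
proof -
  have x: "x \<in> W" "distinct (map fst (walls x))" "\<one>\<^bsub>X\<^esub> \<notin> snd ` set (walls x)"
    using assms by (auto simp: taut_def)
  have wp: "H \<subseteq> carrier X \<and> h \<in> carrier X" if "(H, h) \<in> set (walls x)" for H h
    using walls_wall_pairs[OF x(1)] that by (auto simp: wall_pairs_def)
  let ?g = "val [(u, a)]"
  have g: "?g \<in> carrier X" using assms by simp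
  have "inj_on ((`) (conjugate ?g)) (fst ` set (walls x))"
    using wp conjugate_image_eq_iff[OF g] by (intro inj_onI) (auto simp: fst_eq_Domain)
  then have "distinct (map ((`) (conjugate ?g)) (map fst (walls x)))" 
    unfolding distinct_map[of _ "map fst (walls x)"] set_map using x(2) by simp
  moreover have "vertex_image u \<noteq> conjugate ?g ` H" if "(H, h) \<in> set (walls x)" for H h
  proof
    assume "vertex_image u = conjugate ?g ` H"
    then have "conjugate ?g ` H = conjugate ?g ` vertex_image u" using conjugate_vertex_image[of u a] assms(2,3) by (metis DiffD1)
    then have "H = vertex_image u" using conjugate_image_eq_iff[OF g, of H "vertex_image u"] wp[OF that] vertex_image_closed[OF assms(2)] by simp
    then show False using assms(4) fst_imageI[OF that] by simp
  qed
  moreover have "conjugate ?g h \<noteq> \<one>\<^bsub>X\<^esub>" if "(H, h) \<in> set (walls x)" for H h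
  proof
    assume "conjugate ?g h = \<one>\<^bsub>X\<^esub>"
    then have "h = \<one>\<^bsub>X\<^esub>" using conjugate_eq_one_iff[OF g, of h] wp[OF that] by simp
    then show False using x(3) snd_imageI[OF that] by simp
  qed
  ultimately show ?thesis
    using assms x val_eq_one_iff[of u a] by (fastforce simp: taut_def o_def)
qed

lemma walls_nth_append:
  assumes "x @ s # y \<in> W"
  shows "walls (x @ s # y) ! length x = conjugate_wall (val x) (vertex_image (fst s), val [s])"
proof -
  have "walls (x @ s # y) = walls x @ map (conjugate_wall (val x)) (walls (s # y))"
    using assms by (intro walls_append) auto
  then show ?thesis using nth_append_length[of "walls x"] by simp
qed

text \<open>The attached element satisfies \<open>h = x s x^-1\<close>, so \<open>x s = c x\<close>:
  the syllable \<open>s\<close>, whose own vertex may differ from \<open>v\<close>, leaves its place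
  and reappears in front as an element of the group of \<open>v\<close>. The length is
  unchanged.\<close>

lemma exchange:
  assumes "w \<in> W" "v \<in> V" "(vertex_image v, h) \<in> set (walls w)"
  obtains x s y c where "w = x @ s # y" "c \<in> carrier (G v)" "h = val [(v, c)]"
    "walls w ! length x = (vertex_image v, h)" "val w = val ((v, c) # x @ y)"
proof -
  obtain i where i: "i < length w" "walls w ! i = (vertex_image v, h)"
    using assms(3) by (auto simp: in_set_conv_nth)
  define x s y where "x = take i w" and "s = w ! i" and "y = drop (Suc i) w"
  have w: "w = x @ s # y" and x: "length x = i"
    using i id_take_nth_drop[of i w] by (auto simp: x_def s_def y_def)
  have W: "x \<in> W" "[s] \<in> W" "y \<in> W" using assms(1) unfolding w by (cases s; simp)+
  have sy: "s # y \<in> W" using W by (cases s) simp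
  have "h \<in> vertex_image v" using walls_wall_pairs[OF assms(1)] assms(3) by (auto simp: wall_pairs_def)
  then obtain c where c: "c \<in> carrier (G v)" "h = val [(v, c)]" by (auto simp: vertex_image_def)
  have "h = conjugate (val x) (val [s])"
    using i(2) walls_nth_append[of x s y] assms(1) by (simp add: w[symmetric] x)
  then have "val [(v, c)] \<otimes>\<^bsub>X\<^esub> val x = val x \<otimes>\<^bsub>X\<^esub> val [s]"
    using W c by (simp add: conjugate_def X.m_assoc)
  moreover have "val w = val x \<otimes>\<^bsub>X\<^esub> val [s] \<otimes>\<^bsub>X\<^esub> val y"
    using W sy val_append[of x "s # y"] val_Cons[of s y] by (simp add: w X.m_assoc)
  moreover have "val ((v, c) # x @ y) = val [(v, c)] \<otimes>\<^bsub>X\<^esub> val x \<otimes>\<^bsub>X\<^esub> val y"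
    using W c assms(2) val_append[of "[(v, c)]" "x @ y"] val_append[of x y] by (simp add: X.m_assoc)
  ultimately have "val w = val ((v, c) # x @ y)" by simp
  then show thesis using that w c i x by blast
qed

text \<open>If the last letter \<open>s\<close> after the prefix \<open>z\<close> had this wall,
  then \<open>z s = c z\<close> for some \<open>c\<close> over \<open>u\<close>; the shift lemma
  makes \<open>c\<close>, and with it \<open>s\<close>, trivial.\<close>

lemma vertex_image_not_in_walls_alternating:
  assumes "u \<noteq> v" "u \<in> V" "v \<in> V"
    "a \<in> carrier (G u) - {\<one>\<^bsub>G u\<^esub>}" "b \<in> carrier (G v) - {\<one>\<^bsub>G v\<^esub>}"
    "{u, v} \<in> E \<Longrightarrow> k < lab {u, v}"
  shows "vertex_image u \<notin> fst ` set (walls (alternating (v, b) (u, a) k))"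
  using assms(6)
proof (induction k)
  case (Suc k)
  let ?z = "alternating (v, b) (u, a) k"
  define s where "s = (if even k then (v, b) else (u, a))"
  have W: "?z \<in> W" "[s] \<in> W" using assms by (auto intro!: alternating_in_words simp: s_def)
  have z: "alternating (v, b) (u, a) (Suc k) = ?z @ [s]"
    by (simp only: alternating_Suc_snoc s_def)
  have "conjugate (val ?z) ` vertex_image (fst s) \<noteq> vertex_image u"
  proof
    assume eq: "conjugate (val ?z) ` vertex_image (fst s) = vertex_image u"
    have "val [s] \<in> vertex_image (fst s)" using assms by (auto simp: vertex_image_def s_def)
    then have "conjugate (val ?z) (val [s]) \<in> vertex_image u" using eq by blast
    then obtain c where c: "c \<in> carrier (G u)" "conjugate (val ?z) (val [s]) = val [(u, c)]"
      by (auto simp: vertex_image_def)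
    then have "val ?z \<otimes>\<^bsub>X\<^esub> val [s] = val [(u, c)] \<otimes>\<^bsub>X\<^esub> val ?z"
      using W assms(2) by (simp add: c(2)[symmetric] conjugate_def X.m_assoc)
    then have "val (alternating (v, b) (u, a) (Suc k)) = val ((u, c) # ?z)"
      using W c(1) assms(2) val_append[of "[(u, c)]" ?z] by (simp add: z val_append del: alternating.simps)
    then have "c = \<one>\<^bsub>G u\<^esub>"
      using alternating_shift_trivial[OF assms(1-5) c(1) Suc.prems] by blast
    then have "conjugate (val ?z) (val [s]) = conjugate (val ?z) \<one>\<^bsub>X\<^esub>" using c assms W by simp
    then have "val [s] = \<one>\<^bsub>X\<^esub>" using conjugate_eq_one_iff[of "val ?z" "val [s]"] W by simp
    then show False
      using assms(2-5) val_eq_one_iff[of u a] val_eq_one_iff[of v b]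
      by (cases "even k") (simp_all add: s_def)
  qed
  moreover have "vertex_image u \<notin> fst ` set (walls ?z)"
    by (rule Suc.IH) (use Suc.prems in simp)
  ultimately show ?case
    unfolding z walls_append[OF W] by (simp add: image_Un del: alternating.simps)
qed simp

text \<open>The exchanged syllable never lies in the alternating prefix already built, since the wall of
  \<open>u\<close> does not occur there. For non-adjacent \<open>u\<close> and \<open>v\<close> the prefix grows without bound, so the
  hypotheses are contradictory in that case.\<close>

lemma taut_alternating_prefix:
  assumes "taut w" "u \<noteq> v" "u \<in> V" "v \<in> V"
    "a \<in> carrier (G u) - {\<one>\<^bsub>G u\<^esub>}" "b \<in> carrier (G v) - {\<one>\<^bsub>G v\<^esub>}"
    "(vertex_image u, val [(u, a)]) \<in> set (walls w)" "(vertex_image v, val [(v, b)]) \<in> set (walls w)"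
    "{u, v} \<in> E \<Longrightarrow> k \<le> lab {u, v}"
  shows "\<exists>y. taut (alternating (u, a) (v, b) k @ y) \<and> val (alternating (u, a) (v, b) k @ y) = val w"
  using assms(2-)
proof (induction k arbitrary: u v a b)
  case 0
  then show ?case using assms(1) by auto
next
  case (Suc k)
  let ?z = "alternating (v, b) (u, a) k"
  have "{v, u} \<in> E \<Longrightarrow> k \<le> lab {v, u}" using Suc.prems(8) by (simp add: insert_commute)
  \<comment> \<open>The roles of \<open>u\<close> and \<open>v\<close> are swapped: prepending
    \<open>(u, a)\<close> lengthens an alternating prefix that begins with \<open>v\<close>.\<close>
  then obtain y where y: "taut (?z @ y)" "val (?z @ y) = val w"
    using Suc.IH[of v u b a] Suc.prems by blast
  have zyW: "?z @ y \<in> W" using y by (simp add: taut_def)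
  have "(vertex_image u, val [(u, a)]) \<in> set (walls (?z @ y))"
    using taut_walls_subset[OF assms(1) y(1)] y(2) Suc.prems by auto
  then obtain p s q c where e: "?z @ y = p @ s # q" "c \<in> carrier (G u)" "val [(u, a)] = val [(u, c)]"
    "walls (?z @ y) ! length p = (vertex_image u, val [(u, a)])" "val (?z @ y) = val ((u, c) # p @ q)"
    using exchange[OF zyW Suc.prems(2)] by metis
  have c: "c = a" using val_inj[OF Suc.prems(2) _ e(2,3)] Suc.prems(4) by simp
  have "\<not> length p < k"
  proof
    assume p: "length p < k"
    have "walls (?z @ y) ! length p = walls ?z ! length p"
      using zyW p by (simp add: walls_append nth_append)
    then have "(vertex_image u, val [(u, a)]) \<in> set (walls ?z)"
      using p e(4) nth_mem[of "length p" "walls ?z"] by simp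
    then have "vertex_image u \<in> fst ` set (walls ?z)" by (rule fst_imageI)
    moreover have "{u, v} \<in> E \<Longrightarrow> k < lab {u, v}" using Suc.prems(8) by simp
    ultimately show False using vertex_image_not_in_walls_alternating[OF Suc.prems(1-5)] by simp
  qed
  then have "take k p = ?z" using arg_cong[OF e(1), of "take k"] by simp
  then obtain p' where p': "p = ?z @ p'" using append_take_drop_id[of k p] by metis
  have eq: "(u, c) # p @ q = alternating (u, a) (v, b) (Suc k) @ (p' @ q)" by (simp add: c p')
  have "(u, c) # p @ q \<in> W" using e(1,2) zyW Suc.prems by (cases s) simp
  moreover have "length ((u, c) # p @ q) \<le> length (?z @ y)" unfolding e(1) by simp
  ultimately have "taut ((u, c) # p @ q)" using taut_if_length_le[OF y(1)] e(5) by blast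
  then show ?case using e(5) y(2) unfolding eq by metis
qed

text \<open>The first wall of each word is \<open>vertex_image u\<close> itself, so both heads equal
  the holonomy there and can be cancelled.\<close>

lemma taut_same_head:
  assumes "taut ((u, a) # x)" "taut ((u, b) # y)" "val ((u, a) # x) = val ((u, b) # y)"
  shows "a = b" "val x = val y"
proof -
  have W: "u \<in> V" "a \<in> carrier (G u)" "b \<in> carrier (G u)" "x \<in> W" "y \<in> W"
    using assms by (auto simp: taut_def)
  have "(vertex_image u, val [(u, a)]) \<in> set (walls ((u, b) # y))"
    using taut_walls_subset[OF assms] by auto
  then have "val [(u, a)] = val [(u, b)]"
    using taut_holonomy[OF assms(2)] by (metis fst_conv list.set_intros(1) walls.simps(2))
  then show ab: "a = b" using val_inj W by blast
  have "val [(u, a)] \<otimes>\<^bsub>X\<^esub> val x = val [(u, a)] \<otimes>\<^bsub>X\<^esub> val y"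
    using assms(3) W val_Cons[of "(u, a)" x] val_Cons[of "(u, b)" y] by (simp add: ab)
  then show "val x = val y" using W by simp
qed

section \<open>Connecting taut words by dihedral relations\<close>

lemma dihedral_Cons:
  assumes "dihedral\<^sup>*\<^sup>* s t" "u \<in> V" "a \<in> carrier (G u)"
  shows "dihedral\<^sup>*\<^sup>* ((u, a) # s) ((u, a) # t)"
  using assms(1)
proof induction
  case (step y z)
  have "dihedral ((u, a) # y) ((u, a) # z)"
    using step.hyps(2)
  proof cases
    case (1 u' v a' b p q)
    then show ?thesis
      using dihedral_move.intros[of u' v E a' G b "(u, a) # p" V q lab] assms by simp
  qed
  with step.IH show ?case by (rule rtranclp.rtrancl_into_rtrancl)
qed simp

lemma dihedral_imp_move: "dihedral\<^sup>*\<^sup>* s t \<Longrightarrow> move\<^sup>*\<^sup>* s t"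
  by (erule rtranclp_mono[THEN predicate2D, rotated]) (auto simp: elementary_move_def)

lemma taut_dihedral:
  assumes "taut w" "taut w'" "val w = val w'"
  shows "dihedral\<^sup>*\<^sup>* w w'"
  using assms
proof (induction "length w" arbitrary: w w' rule: less_induct)
  case less
  have same: "dihedral\<^sup>*\<^sup>* ((u, a) # p) ((u, b) # q)"
    if "taut ((u, a) # p)" "taut ((u, b) # q)" "val ((u, a) # p) = val ((u, b) # q)"
      "length ((u, a) # p) \<le> length w" for u a p b q
  proof -
    note h = taut_same_head[OF that(1-3)]
    have "dihedral\<^sup>*\<^sup>* p q"
      using that h taut_Cons_tail by (intro less.hyps) auto
    then show ?thesis using dihedral_Cons taut_Cons_nontrivial[OF that(1)] h by simp
  qed
  have len: "length w = length w'"
    using less.prems taut_length_le[of w w'] taut_length_le[of w' w] by (simp add: taut_def)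
  show ?case
  proof (cases w)
    case Nil
    then show ?thesis using len by simp
  next
    case (Cons s x)
    then obtain t y where w': "w' = t # y" using len by (cases w') auto
    obtain u a v b where s: "s = (u, a)" and t: "t = (v, b)" by force
    note w = Cons[unfolded s] and w' = w'[unfolded t]
    have u: "u \<in> V" "a \<in> carrier (G u) - {\<one>\<^bsub>G u\<^esub>}" and v: "v \<in> V" "b \<in> carrier (G v) - {\<one>\<^bsub>G v\<^esub>}"
      using taut_Cons_nontrivial less.prems unfolding w w' by blast+
    show ?thesis
    proof (cases "u = v")
      case True
      then show ?thesis using same[of u a x b y] less.prems unfolding w w' by simp
    next
      case False
      have walls: "(vertex_image u, val [(u, a)]) \<in> set (walls w)" "(vertex_image v, val [(v, b)]) \<in> set (walls w)"
        using taut_walls_subset[OF less.prems(2,1)] less.prems(3) by (auto simp: w w')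
      note prefix = taut_alternating_prefix[OF less.prems(1) False u(1) v(1) u(2) v(2) walls]
      \<comment> \<open>Without an edge there would be a taut word for the same element with an
        alternating prefix longer than \<open>w\<close>, against minimality.\<close>
      have E: "{u, v} \<in> E"
      proof (rule ccontr)
        assume "{u, v} \<notin> E"
        then obtain z where z: "taut (alternating (u, a) (v, b) (Suc (length w)) @ z)"
          "val (alternating (u, a) (v, b) (Suc (length w)) @ z) = val w"
          using prefix[of "Suc (length w)"] by blast
        from taut_length_le[OF z(1) _ z(2)] less.prems(1) show False
          by (simp add: taut_def del: alternating.simps)
      qed
      obtain m where m: "lab {u, v} = Suc m" using label_ge_2[OF E] by (cases "lab {u, v}") auto
      obtain z where z: "taut (alternating (u, a) (v, b) (lab {u, v}) @ z)"
          "val (alternating (u, a) (v, b) (lab {u, v}) @ z) = val w"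
        using prefix[of "lab {u, v}"] by blast
      \<comment> \<open>The bridge: \<open>?p\<close> starts over the same vertex as
        \<open>w\<close>, \<open>?q\<close> over the same vertex as \<open>w'\<close>, and one
        dihedral relation joins them.\<close>
      let ?p = "alternating (u, a) (v, b) (lab {u, v}) @ z"
      let ?q = "alternating (v, b) (u, a) (lab {u, v}) @ z"
      have "dihedral ([] @ alternating (u, a) (v, b) (lab {u, v}) @ z) ([] @ alternating (v, b) (u, a) (lab {u, v}) @ z)"
        using E u v z(1) by (intro dihedral_move.intros) (auto simp: taut_def)
      then have pq: "dihedral ?p ?q" by simp
      then have mv: "move ?p ?q" by (simp add: elementary_move_def)
      have vq: "val ?q = val w" using val_move[OF mv] z(2) by simp
      have tq: "taut ?q"
        using taut_if_length_le[OF z(1)] move_words[OF mv] vq z(2) by simp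
      have lz: "length ?p \<le> length w"
        using taut_length_le[OF z(1) _ z(2)] less.prems by (simp add: taut_def)
      have "dihedral\<^sup>*\<^sup>* w ?p"
        using same[of u a x a "alternating (v, b) (u, a) m @ z"] less.prems z by (simp add: w m)
      moreover have "dihedral\<^sup>*\<^sup>* ?q w'"
        using same[of v b "alternating (u, a) (v, b) m @ z" b y] less.prems tq vq lz
        by (simp add: w' m)
      ultimately show ?thesis using pq by (meson rtranclp.rtrancl_into_rtrancl rtranclp_trans)
    qed
  qed
qed

section \<open>Shortening words that are not taut\<close>

lemma move_Cons:
  assumes "move\<^sup>*\<^sup>* s t" "u \<in> V" "a \<in> carrier (G u)"
  shows "move\<^sup>*\<^sup>* ((u, a) # s) ((u, a) # t)"
  using assms(1)
proof induction
  case (step y z)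
  have "move ([(u, a)] @ y @ []) ([(u, a)] @ z @ [])"
    using step.hyps(2) assms by (intro move_context) auto
  then have "move ((u, a) # y) ((u, a) # z)" by simp
  with step.IH show ?case by (rule rtranclp.rtrancl_into_rtrancl)
qed simp

text \<open>In the essential case the tail is taut and already has the wall of the head. Exchange
  gives a taut word for the tail starting over the same vertex; dihedral relations reach it by
  forward moves, and a fusion then saves a syllable.\<close>

lemma taut_or_shortenable:
  "w \<in> W \<Longrightarrow> taut w \<or> (\<exists>w'. move\<^sup>*\<^sup>* w w' \<and> length w' < length w)"
proof (induction w)
  case Nil
  then show ?case by (simp add: taut_def)
next
  case (Cons s x)
  obtain u a where s: "s = (u, a)" by force
  have u: "u \<in> V" "a \<in> carrier (G u)" "x \<in> W" using Cons.prems by (auto simp: s)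
  consider (short) x' where "move\<^sup>*\<^sup>* x x'" "length x' < length x"
    | (one) "a = \<one>\<^bsub>G u\<^esub>"
    | (wall) "taut x" "vertex_image u \<in> fst ` set (walls x)"
    | (taut) "taut (s # x)"
    using Cons.IH[OF u(3)] taut_ConsI[of x u a] u by (auto simp: s)
  then show ?case
  proof cases
    case short
    then show ?thesis using move_Cons[OF short(1) u(1,2)] by (intro disjI2 exI[of _ "s # x'"]) (auto simp: s)
  next
    case one
    have "reduction_move V G ([] @ [(u, \<one>\<^bsub>G u\<^esub>)] @ x) ([] @ x)"
      using u by (intro reduction_move.intros) auto
    then have "move (s # x) x" by (simp add: s one elementary_move_def)
    then show ?thesis by (intro disjI2 exI[of _ x]) auto
  next
    case wall
    then obtain h where h: "(vertex_image u, h) \<in> set (walls x)" by auto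
    obtain p t q c where e: "x = p @ t # q" "c \<in> carrier (G u)" "val x = val ((u, c) # p @ q)"
      using exchange[OF u(3,1) h] by metis
    have W: "(u, c) # p @ q \<in> W" using e u by (cases t) auto
    have "taut ((u, c) # p @ q)" using taut_if_length_le[OF wall(1) W e(3)] e(1) by simp
    then have "move\<^sup>*\<^sup>* x ((u, c) # p @ q)"
      using taut_dihedral[OF wall(1)] e(3) dihedral_imp_move by blast
    then have "move\<^sup>*\<^sup>* (s # x) ((u, a) # (u, c) # p @ q)" using move_Cons u by (simp add: s)
    moreover have "fusion_move V G ([] @ [(u, a), (u, c)] @ p @ q) ([] @ [(u, a \<otimes>\<^bsub>G u\<^esub> c)] @ p @ q)"
      using u e W by (intro fusion_move.intros) auto
    then have "move ((u, a) # (u, c) # p @ q) ((u, a \<otimes>\<^bsub>G u\<^esub> c) # p @ q)"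
      by (simp add: elementary_move_def)
    ultimately have "move\<^sup>*\<^sup>* (s # x) ((u, a \<otimes>\<^bsub>G u\<^esub> c) # p @ q)"
      by (rule rtranclp.rtrancl_into_rtrancl)
    then show ?thesis using e(1) by (intro disjI2 exI[of _ "(u, a \<otimes>\<^bsub>G u\<^esub> c) # p @ q"]) auto
  qed simp
qed

lemma moves_words_val: "\<lbrakk>move\<^sup>*\<^sup>* w w'; w \<in> W\<rbrakk> \<Longrightarrow> w' \<in> W \<and> val w' = val w"
  by (induction rule: rtranclp_induct) (use move_words val_move in auto)

lemma graphically_reduced_iff_taut: "graphically_reduced V E lab G w \<longleftrightarrow> taut w"
proof
  assume "graphically_reduced V E lab G w"
  then show "taut w" using taut_or_shortenable[of w] by (auto simp: graphically_reduced_def)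
next
  assume w: "taut w"
  have "length w \<le> length w'" if "move\<^sup>*\<^sup>* w w'" for w'
    using taut_length_le[OF w] moves_words_val[OF that] w by (simp add: taut_def)
  then show "graphically_reduced V E lab G w" using w by (fastforce simp: graphically_reduced_def taut_def)
qed

lemma taut_iff_minimal:
  assumes "w \<in> W"
  shows "taut w \<longleftrightarrow> (\<forall>w'\<in>W. val w' = val w \<longrightarrow> length w \<le> length w')"
  using taut_length_le[of w] taut_or_shortenable[OF assms] moves_words_val[OF _ assms]
  by (metis leD)

end

theorem proposition5p8:
  fixes V :: "'v set" and E :: "'v set set" and lab :: "'v set \<Rightarrow> nat"
    and G :: "'v \<Rightarrow> ('a, 'b) monoid_scheme" and g :: "('v, 'a) word set set"
  assumes "periagroup_data V E lab G"
    and "g \<in> carrier (periagroup V E lab G)"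
  shows "(\<forall>w. represents V E lab G w g \<longrightarrow>
            ((\<forall>w'. represents V E lab G w' g \<longrightarrow> length w \<le> length w')
              \<longleftrightarrow> graphically_reduced V E lab G w))
       \<and> (\<forall>w w'. represents V E lab G w g \<and> graphically_reduced V E lab G w
            \<and> represents V E lab G w' g \<and> graphically_reduced V E lab G w'
            \<longrightarrow> (dihedral_move V E lab G)\<^sup>*\<^sup>* w w')"
proof -
  interpret periagroup_presentation V E lab G
    by standard (rule assms(1))
  show ?thesis
    using taut_iff_minimal taut_dihedral
    unfolding represents_def graphically_reduced_iff_taut by blast
qed

end
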